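(* Let $(M,g)$ be a Riemannian manifold of dimension $n\ge 4$, and let $[g]$ denote the conformal class of $g$. Assume that some metric $\tilde g\in[g]$ admits a nowhere vanishing parallel vector field. Then for every $p\in M$ there is a nonzero tangent vector $v\in T_pM$ such that the Weyl operator $W_p:\Lambda^2(T_pM)\to\Lambda^2(T_pM)$ of any metric in $[g]$ satisfies $$W_p(v\wedge v^{\perp})\subset v\wedge v^{\perp}.$$ In particular, for every $p\in M$, $W_p$ has at least $n-1$ linearly independent eigenvectors which are simple bivectors.
   Context: The conformal class is $[g]=\{e^{2f}g: f\in C^\infty(M)\}$. A vector field $X$ is parallel for $\tilde g$ if $\tilde\nabla X=0$, with $\tilde\nabla$ the Levi-Civita connection of $\tilde g$. The Weyl tensor $W$ is defined by $R=W+P$ (all as $(0,4)$ tensors), where $S=\frac{1}{n-2}\left(\mathrm{Ric}-\frac{s}{2(n-1)}g\right)$ is the Schouten tensor, $s$ the scalar curvature, and $P$ is the Kulkarni–Nomizu product of $S$ and $g$, that is, $P_{ijkl}=S_{ik}g_{jl}+g_{ik}S_{jl}-S_{il}g_{jk}-S_{jk}g_{il}$. At a point $p$, $W_p$ is regarded as a symmetric endomorphism of $\Lambda^2(T_pM)$ (with the inner product induced by the metric) through $\langle W_p(x\wedge y),z\wedge t\rangle=W_p(x,y,z,t)$. Here $v^\perp\subset T_pM$ is the orthogonal complement of $v$ and $v\wedge v^\perp=\{v\wedge w: w\in v^\perp\}$. A bivector is simple if it equals $x\wedge y$ for some $x,y\in T_pM$. *)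

theory Defs
  imports "HOL-Analysis.Analysis"
begin

section \<open>Smooth manifolds\<close>

definition pderiv_at :: "'n \<Rightarrow> (real ^ 'n \<Rightarrow> real) \<Rightarrow> real ^ 'n \<Rightarrow> real"
  where "pderiv_at i f x = frechet_derivative f (at x) (axis i 1)"

text \<open>Only meant for open \<open>S\<close>: all iterated partial derivatives exist, and are differentiable
  (hence continuous).\<close>

fun Ck_on :: "nat \<Rightarrow> (real ^ 'n::finite \<Rightarrow> 'b::real_normed_vector) \<Rightarrow> (real ^ 'n) set \<Rightarrow> bool"
  where
    "Ck_on 0 f S \<longleftrightarrow> continuous_on S f"
  | "Ck_on (Suc k) f S \<longleftrightarrow> f differentiable_on S \<and>
       (\<forall>i. Ck_on k (\<lambda>x. frechet_derivative f (at x) (axis i 1)) S)"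

definition smooth_on :: "(real ^ 'n::finite \<Rightarrow> 'b::real_normed_vector) \<Rightarrow> (real ^ 'n) set \<Rightarrow> bool"
  where "smooth_on f S \<longleftrightarrow> (\<forall>k. Ck_on k f S)"

type_synonym ('a, 'n) chart = "'a set \<times> ('a \<Rightarrow> real ^ 'n)"

abbreviation cdom :: "('a, 'n) chart \<Rightarrow> 'a set" where "cdom c \<equiv> fst c"

abbreviation cmap :: "('a, 'n) chart \<Rightarrow> 'a \<Rightarrow> real ^ 'n" where "cmap c \<equiv> snd c"

abbreviation cimg :: "('a, 'n) chart \<Rightarrow> (real ^ 'n) set" where "cimg c \<equiv> cmap c ` cdom c"

abbreviation cinv :: "('a, 'n) chart \<Rightarrow> real ^ 'n \<Rightarrow> 'a"
  where "cinv c \<equiv> inv_into (cdom c) (cmap c)"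

text \<open>The dimension of the manifold is \<open>CARD('n)\<close>. The atlas need not be maximal.\<close>

definition smooth_manifold :: "'a topology \<Rightarrow> ('a, 'n::finite) chart set \<Rightarrow> bool"
  where "smooth_manifold M A \<longleftrightarrow>
    Hausdorff_space M \<and> second_countable M \<and>
    (\<forall>c\<in>A. openin M (cdom c) \<and> open (cimg c) \<and>
       homeomorphic_map (subtopology M (cdom c)) (top_of_set (cimg c)) (cmap c)) \<and>
    (\<Union>c\<in>A. cdom c) = topspace M \<and>
    (\<forall>c\<in>A. \<forall>d\<in>A. smooth_on (cmap d \<circ> cinv c) (cmap c ` (cdom c \<inter> cdom d)))"

definition smooth_fun :: "('a, 'n::finite) chart set \<Rightarrow> ('a \<Rightarrow> real) \<Rightarrow> bool"
  where "smooth_fun A f \<longleftrightarrow> (\<forall>c\<in>A. smooth_on (f \<circ> cinv c) (cimg c))"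

section \<open>Tangent vectors, vector fields and metrics\<close>

text \<open>Fix a chart \<open>chart_at A p\<close> around each point \<open>p\<close>. The tangent space at \<open>p\<close> is represented
  by the type \<open>real ^ 'n\<close>: the vector \<open>v\<close> stands for the tangent vector with components \<open>v\<close>
  in \<open>chart_at A p\<close>. Components in another chart \<open>c\<close> are obtained by applying the
  differential of the transition map.\<close>

definition chart_at :: "('a, 'n) chart set \<Rightarrow> 'a \<Rightarrow> ('a, 'n) chart"
  where "chart_at A p = (SOME c. c \<in> A \<and> p \<in> cdom c)"

definition to_chart :: "('a, 'n::finite) chart set \<Rightarrow> ('a, 'n) chart \<Rightarrow> 'a \<Rightarrow> real ^ 'n \<Rightarrow> real ^ 'n"
  where "to_chart A c p v =
    frechet_derivative (cmap c \<circ> cinv (chart_at A p)) (at (cmap (chart_at A p) p)) v"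

text \<open>The coordinate vector \<open>\<partial>/\<partial>x\<^sub>i\<close> of the chart \<open>c\<close> at \<open>p\<close>, as an element of the tangent
  space at \<open>p\<close>.\<close>

definition coord_vec :: "('a, 'n::finite) chart set \<Rightarrow> ('a, 'n) chart \<Rightarrow> 'a \<Rightarrow> 'n \<Rightarrow> real ^ 'n"
  where "coord_vec A c p i =
    frechet_derivative (cmap (chart_at A p) \<circ> cinv c) (at (cmap c p)) (axis i 1)"

definition field_coord ::
    "('a, 'n::finite) chart set \<Rightarrow> ('a \<Rightarrow> real ^ 'n) \<Rightarrow> ('a, 'n) chart \<Rightarrow> real ^ 'n \<Rightarrow> real ^ 'n"
  where "field_coord A X c x = to_chart A c (cinv c x) (X (cinv c x))"

definition smooth_vector_field :: "('a, 'n::finite) chart set \<Rightarrow> ('a \<Rightarrow> real ^ 'n) \<Rightarrow> bool"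
  where "smooth_vector_field A X \<longleftrightarrow> (\<forall>c\<in>A. smooth_on (field_coord A X c) (cimg c))"

type_synonym ('a, 'n) metric_field = "'a \<Rightarrow> real ^ 'n \<Rightarrow> real ^ 'n \<Rightarrow> real"

definition metric_coord ::
    "('a, 'n::finite) chart set \<Rightarrow> ('a, 'n) metric_field \<Rightarrow> ('a, 'n) chart \<Rightarrow> real ^ 'n \<Rightarrow> real ^ 'n ^ 'n"
  where "metric_coord A g c x =
    (\<chi> i j. g (cinv c x) (coord_vec A c (cinv c x) i) (coord_vec A c (cinv c x) j))"

definition riemannian_metric ::
    "'a topology \<Rightarrow> ('a, 'n::finite) chart set \<Rightarrow> ('a, 'n) metric_field \<Rightarrow> bool"
  where "riemannian_metric M A g \<longleftrightarrow>
    (\<forall>p\<in>topspace M. bilinear (g p) \<and> (\<forall>v w. g p v w = g p w v) \<and> (\<forall>v. v \<noteq> 0 \<longrightarrow> 0 < g p v v)) \<and>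
    (\<forall>c\<in>A. smooth_on (metric_coord A g c) (cimg c))"

definition conformal_class ::
    "('a, 'n::finite) chart set \<Rightarrow> ('a, 'n) metric_field \<Rightarrow> ('a, 'n) metric_field set"
  where "conformal_class A g = {\<lambda>p v w. exp (2 * f p) * g p v w | f. smooth_fun A f}"

section \<open>Levi-Civita connection and curvature in local coordinates\<close>

text \<open>In this section \<open>G\<close> is the matrix of a metric in a chart. \<open>christoffel G x k i j\<close> is the
  symbol with upper index \<open>k\<close> and lower indices \<open>i\<close>, \<open>j\<close>; see \<open>christoffel_unique\<close> below.\<close>

definition christoffel ::
    "(real ^ 'n::finite \<Rightarrow> real ^ 'n ^ 'n) \<Rightarrow> real ^ 'n \<Rightarrow> 'n \<Rightarrow> 'n \<Rightarrow> 'n \<Rightarrow> real"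
  where "christoffel G x k i j = (\<Sum>l\<in>UNIV. matrix_inv (G x) $ k $ l *
    (pderiv_at i (\<lambda>y. G y $ j $ l) x + pderiv_at j (\<lambda>y. G y $ i $ l) x
      - pderiv_at l (\<lambda>y. G y $ i $ j) x) / 2)"

text \<open>The \<open>k\<close>-th component of the covariant derivative of the field with components \<open>Y\<close> in the
  direction of the \<open>i\<close>-th coordinate vector.\<close>

definition cov_deriv ::
    "(real ^ 'n::finite \<Rightarrow> real ^ 'n ^ 'n) \<Rightarrow> (real ^ 'n \<Rightarrow> real ^ 'n) \<Rightarrow> real ^ 'n \<Rightarrow> 'n \<Rightarrow> 'n \<Rightarrow> real"
  where "cov_deriv G Y x i k =
    pderiv_at i (\<lambda>y. Y y $ k) x + (\<Sum>j\<in>UNIV. christoffel G x k i j * Y x $ j)"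

definition parallel_field ::
    "('a, 'n::finite) chart set \<Rightarrow> ('a, 'n) metric_field \<Rightarrow> ('a \<Rightarrow> real ^ 'n) \<Rightarrow> bool"
  where "parallel_field A g X \<longleftrightarrow> smooth_vector_field A X \<and>
    (\<forall>c\<in>A. \<forall>x\<in>cimg c. \<forall>i k. cov_deriv (metric_coord A g c) (field_coord A X c) x i k = 0)"

text \<open>\<open>riem_up G x i j k l\<close> is the \<open>i\<close>-th component of \<open>R(\<partial>\<^sub>k, \<partial>\<^sub>l) \<partial>\<^sub>j\<close>, where
  \<open>R(X, Y) = [\<nabla>\<^sub>X, \<nabla>\<^sub>Y] - \<nabla>\<^bsub>[X,Y]\<^esub>\<close>. With this sign \<open>R(x, y, x, y)\<close> is the sectional curvature for
  orthonormal \<open>x\<close>, \<open>y\<close>, and \<open>Ric\<^bsub>jl\<^esub> = g\<^sup>i\<^sup>k R\<^bsub>ijkl\<^esub>\<close> is positive on round spheres, in accordance with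
  the sign of the Kulkarni-Nomizu product below.\<close>

definition riem_up ::
    "(real ^ 'n::finite \<Rightarrow> real ^ 'n ^ 'n) \<Rightarrow> real ^ 'n \<Rightarrow> 'n \<Rightarrow> 'n \<Rightarrow> 'n \<Rightarrow> 'n \<Rightarrow> real"
  where "riem_up G x i j k l =
    pderiv_at k (\<lambda>y. christoffel G y i l j) x - pderiv_at l (\<lambda>y. christoffel G y i k j) x
    + (\<Sum>m\<in>UNIV. christoffel G x i k m * christoffel G x m l j
               - christoffel G x i l m * christoffel G x m k j)"

definition riem ::
    "(real ^ 'n::finite \<Rightarrow> real ^ 'n ^ 'n) \<Rightarrow> real ^ 'n \<Rightarrow> 'n \<Rightarrow> 'n \<Rightarrow> 'n \<Rightarrow> 'n \<Rightarrow> real"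
  where "riem G x i j k l = (\<Sum>m\<in>UNIV. G x $ i $ m * riem_up G x m j k l)"

definition ricci :: "(real ^ 'n::finite \<Rightarrow> real ^ 'n ^ 'n) \<Rightarrow> real ^ 'n \<Rightarrow> 'n \<Rightarrow> 'n \<Rightarrow> real"
  where "ricci G x j l = (\<Sum>i\<in>UNIV. \<Sum>k\<in>UNIV. matrix_inv (G x) $ i $ k * riem G x i j k l)"

definition scalar_curv :: "(real ^ 'n::finite \<Rightarrow> real ^ 'n ^ 'n) \<Rightarrow> real ^ 'n \<Rightarrow> real"
  where "scalar_curv G x = (\<Sum>j\<in>UNIV. \<Sum>l\<in>UNIV. matrix_inv (G x) $ j $ l * ricci G x j l)"

definition schouten :: "(real ^ 'n::finite \<Rightarrow> real ^ 'n ^ 'n) \<Rightarrow> real ^ 'n \<Rightarrow> 'n \<Rightarrow> 'n \<Rightarrow> real"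
  where "schouten G x i j = 1 / (real CARD('n) - 2) *
    (ricci G x i j - scalar_curv G x / (2 * (real CARD('n) - 1)) * G x $ i $ j)"

definition kulkarni_nomizu ::
    "('n \<Rightarrow> 'n \<Rightarrow> real) \<Rightarrow> ('n \<Rightarrow> 'n \<Rightarrow> real) \<Rightarrow> 'n \<Rightarrow> 'n \<Rightarrow> 'n \<Rightarrow> 'n \<Rightarrow> real"
  where "kulkarni_nomizu s h i j k l =
    s i k * h j l + h i k * s j l - s i l * h j k - s j k * h i l"

definition weyl ::
    "(real ^ 'n::finite \<Rightarrow> real ^ 'n ^ 'n) \<Rightarrow> real ^ 'n \<Rightarrow> 'n \<Rightarrow> 'n \<Rightarrow> 'n \<Rightarrow> 'n \<Rightarrow> real"
  where "weyl G x i j k l =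
    riem G x i j k l - kulkarni_nomizu (schouten G x) (\<lambda>a b. G x $ a $ b) i j k l"

section \<open>Bivectors and the Weyl operator\<close>

text \<open>The \<open>(0,4)\<close> Weyl tensor on the tangent space at \<open>p\<close>, evaluated in the chart that
  represents this tangent space.\<close>

definition weyl_tensor ::
    "('a, 'n::finite) chart set \<Rightarrow> ('a, 'n) metric_field \<Rightarrow> 'a
      \<Rightarrow> real ^ 'n \<Rightarrow> real ^ 'n \<Rightarrow> real ^ 'n \<Rightarrow> real ^ 'n \<Rightarrow> real"
  where "weyl_tensor A g p x y z t =
    (\<Sum>i\<in>UNIV. \<Sum>j\<in>UNIV. \<Sum>k\<in>UNIV. \<Sum>l\<in>UNIV.
       weyl (metric_coord A g (chart_at A p)) (cmap (chart_at A p) p) i j k l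
         * x $ i * y $ j * z $ k * t $ l)"

text \<open>The exterior square of \<open>real ^ 'n\<close> is realised as the space of antisymmetric matrices,
  via \<open>x \<and> y = x \<otimes> y - y \<otimes> x\<close>.\<close>

definition bivectors :: "(real ^ 'n ^ 'n) set"
  where "bivectors = {\<omega>. \<forall>i j. \<omega> $ i $ j = - \<omega> $ j $ i}"

definition wedge :: "real ^ 'n \<Rightarrow> real ^ 'n \<Rightarrow> real ^ 'n ^ 'n"
  where "wedge x y = (\<chi> i j. x $ i * y $ j - x $ j * y $ i)"

definition simple_bivector :: "real ^ 'n ^ 'n \<Rightarrow> bool"
  where "simple_bivector \<omega> \<longleftrightarrow> (\<exists>x y. \<omega> = wedge x y)"

text \<open>The inner product on bivectors induced by an inner product \<open>b\<close>; see
  \<open>bivector_inner_wedge\<close> below.\<close>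

definition bivector_inner ::
    "(real ^ 'n::finite \<Rightarrow> real ^ 'n \<Rightarrow> real) \<Rightarrow> real ^ 'n ^ 'n \<Rightarrow> real ^ 'n ^ 'n \<Rightarrow> real"
  where "bivector_inner b \<omega> \<eta> = (\<Sum>i\<in>UNIV. \<Sum>j\<in>UNIV. \<Sum>k\<in>UNIV. \<Sum>l\<in>UNIV.
    \<omega> $ i $ j * \<eta> $ k $ l * b (axis i 1) (axis k 1) * b (axis j 1) (axis l 1)) / 2"

text \<open>Simple bivectors span \<open>bivectors\<close> and \<open>bivector_inner (g p)\<close> is nondegenerate there, so the
  condition below determines the operator on \<open>bivectors\<close>. Its values elsewhere are irrelevant.\<close>

definition weyl_operator ::
    "('a, 'n::finite) chart set \<Rightarrow> ('a, 'n) metric_field \<Rightarrow> 'a \<Rightarrow> real ^ 'n ^ 'n \<Rightarrow> real ^ 'n ^ 'n"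
  where "weyl_operator A g p = (SOME T. linear T \<and> T ` bivectors \<subseteq> bivectors \<and>
    (\<forall>x y z t. bivector_inner (g p) (T (wedge x y)) (wedge z t) = weyl_tensor A g p x y z t))"

definition wedge_perp :: "(real ^ 'n \<Rightarrow> real ^ 'n \<Rightarrow> real) \<Rightarrow> real ^ 'n \<Rightarrow> (real ^ 'n ^ 'n) set"
  where "wedge_perp b v = {wedge v w | w. b v w = 0}"

section \<open>Consistency of the definitions\<close>

lemma chart_at:
  assumes "smooth_manifold M A" "p \<in> topspace M"
  shows "chart_at A p \<in> A" "p \<in> cdom (chart_at A p)"
proof -
  have "\<exists>c. c \<in> A \<and> p \<in> cdom c"
    using assms unfolding smooth_manifold_def by blast
  then have "chart_at A p \<in> A \<and> p \<in> cdom (chart_at A p)"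
    unfolding chart_at_def by (rule someI_ex)
  then show "chart_at A p \<in> A" "p \<in> cdom (chart_at A p)" by auto
qed

lemma coord_vec_chart_at:
  assumes "smooth_manifold M A" "p \<in> topspace M"
  shows "coord_vec A (chart_at A p) p i = axis i 1"
proof -
  let ?c = "chart_at A p"
  note c = chart_at[OF assms]
  have op: "open (cimg ?c)" using assms(1) c(1) unfolding smooth_manifold_def by blast
  have "((\<lambda>x. x) has_derivative (\<lambda>x. x)) (at (cmap ?c p))" by (rule has_derivative_ident)
  then have "(cmap ?c \<circ> cinv ?c has_derivative (\<lambda>x. x)) (at (cmap ?c p))"
    by (rule has_derivative_transform_within_open[OF _ op]) (use c in \<open>auto simp: f_inv_into_f\<close>)
  then show ?thesis
    unfolding coord_vec_def using frechet_derivative_at by metis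
qed

lemma bivector_inner_wedge:
  assumes "bilinear b"
  shows "bivector_inner b (wedge x y) (wedge z t) = b x z * b y t - b x t * b y z"
proof -
  have ex: "b u v = (\<Sum>i\<in>UNIV. \<Sum>k\<in>UNIV. u $ i * v $ k * b (axis i 1) (axis k 1))" for u v
  proof -
    have "b u v = b (\<Sum>i\<in>UNIV. u $ i *\<^sub>R axis i 1) (\<Sum>k\<in>UNIV. v $ k *\<^sub>R axis k 1)"
      by (metis (no_types) basis_expansion scalar_mult_eq_scaleR)
    also have "\<dots> = (\<Sum>(i,k)\<in>UNIV \<times> UNIV. b (u $ i *\<^sub>R axis i 1) (v $ k *\<^sub>R axis k 1))"
      using assms by (rule bilinear_sum)
    also have "\<dots> = (\<Sum>i\<in>UNIV. \<Sum>k\<in>UNIV. u $ i * v $ k * b (axis i 1) (axis k 1))"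
      by (simp add: sum.cartesian_product bilinear_lmul[OF assms] bilinear_rmul[OF assms] mult_ac)
    finally show ?thesis .
  qed
  define F where "F u v w s = (\<Sum>i\<in>UNIV. \<Sum>j\<in>UNIV. \<Sum>k\<in>UNIV. \<Sum>l\<in>UNIV.
    (u $ i * v $ j * w $ k * s $ l) * (b (axis i 1) (axis k 1) * b (axis j 1) (axis l 1)))" for u v w s
  have F: "F u v w s = b u w * b v s" for u v w s
  proof -
    have "b u w * b v s = (\<Sum>i\<in>UNIV. \<Sum>j\<in>UNIV. (\<Sum>k\<in>UNIV. u $ i * w $ k * b (axis i 1) (axis k 1)) *
       (\<Sum>l\<in>UNIV. v $ j * s $ l * b (axis j 1) (axis l 1)))"
      by (subst (1 2) ex) (rule sum_product)
    also have "\<dots> = F u v w s"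
      unfolding F_def sum_product by (intro sum.cong refl) (simp add: mult_ac)
    finally show ?thesis by simp
  qed
  have "bivector_inner b (wedge x y) (wedge z t) = (F x y z t - F x y t z - F y x z t + F y x t z) / 2"
    unfolding bivector_inner_def wedge_def F_def
    by (simp add: algebra_simps sum.distrib sum_subtractf)
  then show ?thesis by (simp add: F)
qed

text \<open>The Christoffel symbols are the coefficients of the unique torsion-free metric connection.\<close>

lemma christoffel_unique:
  fixes G :: "real ^ 'n::finite \<Rightarrow> real ^ 'n ^ 'n"
  assumes "open S" "x \<in> S" and sym: "\<And>y i j. y \<in> S \<Longrightarrow> G y $ i $ j = G y $ j $ i"
    and inv: "invertible (G x)"
    and diff: "\<And>i j. (\<lambda>y. G y $ i $ j) differentiable at x"
  shows "(\<forall>k i j. \<Gamma> k i j = \<Gamma> k j i) \<and>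
      (\<forall>k i j. pderiv_at k (\<lambda>y. G y $ i $ j) x =
        (\<Sum>l\<in>UNIV. \<Gamma> l k i * G x $ l $ j) + (\<Sum>l\<in>UNIV. \<Gamma> l k j * G x $ i $ l))
    \<longleftrightarrow> \<Gamma> = christoffel G x"
proof -
  define D where "D k i j = pderiv_at k (\<lambda>y. G y $ i $ j) x" for k i j
  have Dsym: "D k i j = D k j i" for k i j
  proof -
    have "((\<lambda>y. G y $ i $ j) has_derivative frechet_derivative (\<lambda>y. G y $ i $ j) (at x)) (at x)"
      using diff frechet_derivative_works by blast
    then have "((\<lambda>y. G y $ j $ i) has_derivative frechet_derivative (\<lambda>y. G y $ i $ j) (at x)) (at x)"
      by (rule has_derivative_transform_within_open[OF _ assms(1,2)]) (rule sym)
    then show ?thesis unfolding D_def pderiv_at_def using frechet_derivative_at by metis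
  qed
  define H where "H = matrix_inv (G x)"
  have GH: "G x ** H = mat 1" and HG: "H ** G x = mat 1"
    using someI_ex[OF inv[unfolded invertible_def]] unfolding H_def matrix_inv_def by auto
  have GHc: "(\<Sum>k\<in>UNIV. G x $ m $ k * H $ k $ l) = (if m = l then 1 else 0)"
    and HGc: "(\<Sum>k\<in>UNIV. H $ m $ k * G x $ k $ l) = (if m = l then 1 else 0)" for m l
    using arg_cong[OF GH, of "\<lambda>B. B $ m $ l"] arg_cong[OF HG, of "\<lambda>B. B $ m $ l"]
    by (simp_all add: matrix_matrix_mult_def mat_def)
  define C where "C l i j = (D i j l + D j i l - D l i j) / 2" for l i j
  have ch: "christoffel G x k i j = (\<Sum>l\<in>UNIV. H $ k $ l * C l i j)" for k i j
    unfolding christoffel_def C_def D_def H_def by simp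
  have gx: "G x $ i $ j = G x $ j $ i" for i j using sym assms(2) by blast
  have low: "\<Gamma> = christoffel G x \<longleftrightarrow> (\<forall>m i j. (\<Sum>k\<in>UNIV. G x $ m $ k * \<Gamma> k i j) = C m i j)"
    (is "_ = ?R")
  proof
    assume eq: "\<Gamma> = christoffel G x"
    have "(\<Sum>k\<in>UNIV. G x $ m $ k * \<Gamma> k i j) = C m i j" for m i j
    proof -
      have "(\<Sum>k\<in>UNIV. G x $ m $ k * \<Gamma> k i j) = (\<Sum>k\<in>UNIV. \<Sum>l\<in>UNIV. G x $ m $ k * H $ k $ l * C l i j)"
        by (simp add: eq ch sum_distrib_left mult.assoc)
      also have "\<dots> = (\<Sum>l\<in>UNIV. (\<Sum>k\<in>UNIV. G x $ m $ k * H $ k $ l) * C l i j)"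
        by (subst sum.swap) (simp add: sum_distrib_right)
      also have "\<dots> = C m i j" by (simp add: GHc if_distrib[of "\<lambda>a. a * _"] cong: if_cong)
      finally show ?thesis .
    qed
    then show ?R by blast
  next
    assume R: ?R
    have "\<Gamma> m i j = christoffel G x m i j" for m i j
    proof -
      have "christoffel G x m i j = (\<Sum>k\<in>UNIV. \<Sum>l\<in>UNIV. H $ m $ k * G x $ k $ l * \<Gamma> l i j)"
        by (simp add: ch R[rule_format, symmetric] sum_distrib_left mult.assoc)
      also have "\<dots> = (\<Sum>l\<in>UNIV. (\<Sum>k\<in>UNIV. H $ m $ k * G x $ k $ l) * \<Gamma> l i j)"
        by (subst sum.swap) (simp add: sum_distrib_right)
      also have "\<dots> = \<Gamma> m i j" by (simp add: HGc if_distrib[of "\<lambda>a. a * _"] cong: if_cong)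
      finally show ?thesis by simp
    qed
    then show "\<Gamma> = christoffel G x" by blast
  qed
  define L where "L m i j = (\<Sum>k\<in>UNIV. G x $ m $ k * \<Gamma> k i j)" for m i j
  have s1: "(\<Sum>l\<in>UNIV. \<Gamma> l k i * G x $ l $ j) = L j k i" for k i j
    unfolding L_def by (rule sum.cong) (auto simp: gx mult.commute)
  have s2: "(\<Sum>l\<in>UNIV. \<Gamma> l k j * G x $ i $ l) = L i k j" for k i j
    unfolding L_def by (simp add: mult.commute)
  show ?thesis (is "?A \<and> ?B \<longleftrightarrow> _")
  proof
    assume AB: "?A \<and> ?B"
    have Ls: "L m i j = L m j i" for m i j using AB unfolding L_def by simp
    have LB: "D k i j = L j k i + L i k j" for k i j
      using AB unfolding D_def s1 s2 by blast
    have "L m i j = C m i j" for m i j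
      unfolding C_def using LB[of i j m] LB[of j i m] LB[of m i j] Ls[of i j m] Ls[of j i m] Ls[of m i j] by simp
    then show "\<Gamma> = christoffel G x" unfolding low L_def by blast
  next
    assume eq: "\<Gamma> = christoffel G x"
    then have LC: "L m i j = C m i j" for m i j unfolding low L_def by blast
    have Cs: "C m i j = C m j i" for m i j unfolding C_def using Dsym[of m i j] by simp
    have "christoffel G x k i j = christoffel G x k j i" for k i j
      unfolding ch by (rule sum.cong[OF refl], subst Cs, rule refl)
    then have ?A unfolding eq by blast
    moreover have "D k i j = L j k i + L i k j" for k i j
      unfolding LC C_def using Dsym[of k i j] Dsym[of i j k] Dsym[of j i k] by (simp add: field_simps)
    ultimately show "?A \<and> ?B" unfolding D_def s1 s2 by blast
  qed
qed

end

theory Submission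
  imports Defs
begin

text \<open>Let \<open>X\<close> be parallel for \<open>h\<^sub>0\<close> and let \<open>h = e\<^sup>2\<^sup>\<phi> h\<^sub>0\<close>. The vector \<open>v = X p\<close> works for all \<open>h\<close> at
  once. The conformal invariance of the Weyl tensor is not needed: with the Levi-Civita connection
  of \<open>h\<close>, the covariant derivative of \<open>X\<close> is explicit in \<open>X\<close> and \<open>d\<phi>\<close>, and the Ricci identity gives
  \<open>R(w, X, z, t) = a(z) h(w, t) - a(t) h(w, z)\<close> for \<open>w, z, t\<close> orthogonal to \<open>X\<close>. Tracing, the
  Schouten tensor satisfies \<open>S(X, z) = - a(z)\<close>, so \<open>W(X, w, z, t) = 0\<close>: the Weyl operator maps
  \<open>v \<and> v\<^sup>\<bottom>\<close> to itself. Diagonalizing the symmetric form \<open>W(v, w, v, t)\<close> on \<open>v\<^sup>\<bottom>\<close> yields the \<open>n - 1\<close>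
  simple eigenvectors.\<close>

section \<open>Partial derivatives and inverse matrices\<close>

text \<open>Tangent spaces are represented in charts chosen point by point, so the matrix of a
  metric in the chart at \<open>p\<close> is known to be a Gram matrix in the standard basis only at
  \<open>p\<close> itself. Positivity is therefore used there alone; what passes to a neighbourhood
  is invertibility, through the determinant, and the curvature computations run on that
  neighbourhood for symmetric invertible matrix fields with two derivatives. Besides
  \<open>a\<close>, the curvature formula contains tensors \<open>m\<close> and \<open>P\<close> of
  which the contraction argument knows nothing. In R(w, X, z, t) they carry factors h(X, w), h(X, z)
  or h(X, t), which vanish on the complement of X. In the trace they leave m(X, z) + P(z, X), up to
  a multiple of h(X, z), and antisymmetry in the form R(X, X, X, z) = 0 equates this with a(z). The
  extra a(z) turns the coefficient 1 - n in Ric(X, z) into 2 - n, exactly the factor that the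
  Schouten tensor divides out. The Weyl operator is a \<open>SOME\<close> choice, so an operator
  with the defining property has to be constructed before anything can be said about it.\<close>

lemma pderiv_at_eq: "(f has_derivative f') (at x) \<Longrightarrow> pderiv_at i f x = f' (axis i 1)"
  unfolding pderiv_at_def using frechet_derivative_at by metis

lemma pderiv_at_cong:
  assumes "open U" "x \<in> U" "\<And>y. y \<in> U \<Longrightarrow> f y = g y"
  shows "pderiv_at i f x = pderiv_at i g x"
proof -
  have "(f has_derivative f') (at x) \<longleftrightarrow> (g has_derivative f') (at x)" for f'
    using has_derivative_transform_within_open[OF _ assms(1,2), of f f' UNIV g]
      has_derivative_transform_within_open[OF _ assms(1,2), of g f' UNIV f] assms(3) by auto
  then show ?thesis unfolding pderiv_at_def frechet_derivative_def by simp
qed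

lemma differentiable_cong_open:
  assumes "open U" "x \<in> U" "\<And>y. y \<in> U \<Longrightarrow> f y = g y" "f differentiable at x"
  shows "g differentiable at x"
  using has_derivative_transform_within_open[OF _ assms(1,2), of f _ UNIV g] assms(3,4)
  unfolding differentiable_def by blast

lemma pderiv_at_add:
  assumes "f differentiable at x" "g differentiable at x"
  shows "pderiv_at i (\<lambda>y. f y + g y) x = pderiv_at i f x + pderiv_at i g x"
proof -
  have "((\<lambda>y. f y + g y) has_derivative
      (\<lambda>h. frechet_derivative f (at x) h + frechet_derivative g (at x) h)) (at x)"
    using assms unfolding frechet_derivative_works by (rule has_derivative_add)
  from pderiv_at_eq[OF this] show ?thesis unfolding pderiv_at_def by simp
qed

lemma pderiv_at_diff:
  assumes "f differentiable at x" "g differentiable at x"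
  shows "pderiv_at i (\<lambda>y. f y - g y) x = pderiv_at i f x - pderiv_at i g x"
proof -
  have "((\<lambda>y. f y - g y) has_derivative
      (\<lambda>h. frechet_derivative f (at x) h - frechet_derivative g (at x) h)) (at x)"
    using assms unfolding frechet_derivative_works by (rule has_derivative_diff)
  from pderiv_at_eq[OF this] show ?thesis unfolding pderiv_at_def by simp
qed

lemma pderiv_at_mult:
  assumes "f differentiable at x" "g differentiable at x"
  shows "pderiv_at i (\<lambda>y. f y * g y) x = pderiv_at i f x * g x + f x * pderiv_at i g x"
proof -
  have "((\<lambda>y. f y * g y) has_derivative
      (\<lambda>h. f x * frechet_derivative g (at x) h + frechet_derivative f (at x) h * g x)) (at x)"
    using assms unfolding frechet_derivative_works by (rule has_derivative_mult)
  from pderiv_at_eq[OF this] show ?thesis unfolding pderiv_at_def by simp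
qed

lemma pderiv_at_sum:
  assumes "\<And>j. j \<in> S \<Longrightarrow> f j differentiable at x"
  shows "pderiv_at i (\<lambda>y. \<Sum>j\<in>S. f j y) x = (\<Sum>j\<in>S. pderiv_at i (f j) x)"
proof -
  have "((\<lambda>y. \<Sum>j\<in>S. f j y) has_derivative
      (\<lambda>h. \<Sum>j\<in>S. frechet_derivative (f j) (at x) h)) (at x)"
    using assms unfolding frechet_derivative_works by (rule has_derivative_sum)
  from pderiv_at_eq[OF this] show ?thesis unfolding pderiv_at_def by simp
qed

lemma pderiv_at_const: "pderiv_at i (\<lambda>y. c) x = 0"
  using pderiv_at_eq[OF has_derivative_const] .

lemma pderiv_at_exp:
  assumes "f differentiable at x"
  shows "pderiv_at i (\<lambda>y. exp (f y)) x = exp (f x) * pderiv_at i f x"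
proof -
  have "((\<lambda>y. exp (f y)) has_derivative (\<lambda>h. exp (f x) * frechet_derivative f (at x) h)) (at x)"
    using assms unfolding frechet_derivative_works by (auto intro!: derivative_eq_intros)
  from pderiv_at_eq[OF this] show ?thesis unfolding pderiv_at_def by simp
qed

text \<open>One half of Young's theorem. The mean value theorem is used in direction
  \<open>i\<close> only; the increment in direction \<open>j\<close> is then controlled by
  differentiability of the first partial derivative at the single point \<open>x\<close>.\<close>

lemma second_difference_estimate:
  fixes f :: "real ^ 'n::finite \<Rightarrow> real"
  assumes U: "open U" "x \<in> U" and f: "\<And>y. y \<in> U \<Longrightarrow> f differentiable at y"
    and F: "pderiv_at i f differentiable at x" and e: "0 < e"
  shows "\<exists>d>0. \<forall>h. 0 < h \<and> h < d \<longrightarrow>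
    \<bar>f (x + h *\<^sub>R axis i 1 + h *\<^sub>R axis j 1) - f (x + h *\<^sub>R axis i 1) - f (x + h *\<^sub>R axis j 1) + f x
      - h\<^sup>2 * pderiv_at j (pderiv_at i f) x\<bar> \<le> e * h\<^sup>2"
proof -
  define a b where "a = (axis i 1 :: real ^ 'n)" and "b = (axis j 1 :: real ^ 'n)"
  define F' where "F' = frechet_derivative (pderiv_at i f) (at x)"
  have nab: "norm a = 1" "norm b = 1" unfolding a_def b_def by simp_all
  have hF: "(pderiv_at i f has_derivative F') (at x)"
    using F unfolding F'_def frechet_derivative_works .
  then have lin: "linear F'" by (rule has_derivative_linear)
  have L: "pderiv_at j (pderiv_at i f) x = F' b"
    unfolding pderiv_at_def[of j] F'_def b_def ..
  \<comment> \<open>The errors at the two evaluation points are at most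
    \<open>e / 3 * (2 * h)\<close> and \<open>e / 3 * h\<close>, together
    \<open>e * h\<close>.\<close>
  have "0 < e / 3" using e by simp
  then obtain d where d: "d > 0" "\<And>y. norm (y - x) < d \<Longrightarrow>
      \<bar>pderiv_at i f y - pderiv_at i f x - F' (y - x)\<bar> \<le> e / 3 * norm (y - x)"
    using hF unfolding has_derivative_at_alt real_norm_def by blast
  obtain r where r: "r > 0" "ball x r \<subseteq> U" using U open_contains_ball by blast
  \<comment> \<open>The bound by half of \<open>min d r\<close> keeps all points of the square of
    side \<open>h\<close>, whose distance from \<open>x\<close> is at most \<open>2 * h\<close>,
    inside both balls.\<close>
  have main: "\<bar>f (x + h *\<^sub>R a + h *\<^sub>R b) - f (x + h *\<^sub>R a) - f (x + h *\<^sub>R b) + f x - h\<^sup>2 * F' b\<bar> \<le> e * h\<^sup>2"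
    if h: "0 < h" "h < min d r / 2" for h
  proof -
    have nb: "norm (s *\<^sub>R a + t *\<^sub>R b) \<le> s + t" if "0 \<le> s" "0 \<le> t" for s t
      using norm_triangle_ineq[of "s *\<^sub>R a" "t *\<^sub>R b"] that nab by simp
    have inU: "x + s *\<^sub>R a + t *\<^sub>R b \<in> U" if "0 \<le> s" "s \<le> h" "0 \<le> t" "t \<le> h" for s t
    proof -
      have "norm (s *\<^sub>R a + t *\<^sub>R b) < r" using nb[of s t] that h by simp
      moreover have "dist x (x + s *\<^sub>R a + t *\<^sub>R b) = norm (s *\<^sub>R a + t *\<^sub>R b)"
        using norm_minus_cancel[of "s *\<^sub>R a + t *\<^sub>R b"] by (simp add: dist_norm)
      ultimately have "x + s *\<^sub>R a + t *\<^sub>R b \<in> ball x r" by simp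
      then show ?thesis using r by blast
    qed
    have der: "((\<lambda>s. f (x + s *\<^sub>R a + t *\<^sub>R b)) has_real_derivative
        pderiv_at i f (x + s *\<^sub>R a + t *\<^sub>R b)) (at s)" if "0 \<le> s" "s \<le> h" "0 \<le> t" "t \<le> h" for s t
    proof -
      let ?y = "x + s *\<^sub>R a + t *\<^sub>R b"
      have fd: "(f has_derivative frechet_derivative f (at ?y)) (at ?y)"
        using f[OF inU[OF that]] frechet_derivative_works by blast
      have "((\<lambda>s. x + s *\<^sub>R a + t *\<^sub>R b) has_derivative (\<lambda>s. s *\<^sub>R a)) (at s)"
        by (auto intro!: derivative_eq_intros)
      from has_derivative_compose[OF this fd]
      have "((\<lambda>s. f (x + s *\<^sub>R a + t *\<^sub>R b)) has_derivative (\<lambda>s. frechet_derivative f (at ?y) (s *\<^sub>R a))) (at s)" .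
      moreover have "frechet_derivative f (at ?y) (s *\<^sub>R a) = pderiv_at i f ?y * s" for s
        using linear_scale[OF has_derivative_linear[OF fd], of s a]
        unfolding pderiv_at_def a_def by (simp add: mult.commute)
      ultimately show ?thesis unfolding has_field_derivative_def by simp
    qed
    \<comment> \<open>The second difference is the increment of \<open>\<psi>\<close> over
      \<open>[0, h]\<close>, and the derivative of \<open>\<psi>\<close> is a difference of values
      of \<open>pderiv_at i f\<close>; no derivative in direction \<open>j\<close> has been taken
      yet.\<close>
    define \<psi> where "\<psi> s = f (x + s *\<^sub>R a + h *\<^sub>R b) - f (x + s *\<^sub>R a)" for s
    have "(\<psi> has_real_derivative (pderiv_at i f (x + s *\<^sub>R a + h *\<^sub>R b) - pderiv_at i f (x + s *\<^sub>R a))) (at s)"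
      if "0 \<le> s" "s \<le> h" for s
      using DERIV_diff[OF der[OF that, of h] der[OF that, of 0]] h unfolding \<psi>_def by simp
    then obtain s where s: "0 < s" "s < h" and
      mv: "\<psi> h - \<psi> 0 = h * (pderiv_at i f (x + s *\<^sub>R a + h *\<^sub>R b) - pderiv_at i f (x + s *\<^sub>R a))"
      using MVT2[of 0 h \<psi> "\<lambda>s. pderiv_at i f (x + s *\<^sub>R a + h *\<^sub>R b) - pderiv_at i f (x + s *\<^sub>R a)"] h by auto
    define A B where "A = pderiv_at i f (x + s *\<^sub>R a + h *\<^sub>R b) - pderiv_at i f x - F' (s *\<^sub>R a + h *\<^sub>R b)"
      and "B = pderiv_at i f (x + s *\<^sub>R a) - pderiv_at i f x - F' (s *\<^sub>R a)"
    have n1: "norm (s *\<^sub>R a + h *\<^sub>R b) \<le> 2 * h" using nb[of s h] s h by simp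
    have n2: "norm (s *\<^sub>R a) \<le> h" using nab s by simp
    have "\<bar>A\<bar> \<le> e / 3 * norm (s *\<^sub>R a + h *\<^sub>R b)"
      using d(2)[of "x + s *\<^sub>R a + h *\<^sub>R b"] n1 h unfolding A_def by (simp add: add.assoc)
    also have "\<dots> \<le> e / 3 * (2 * h)" using n1 e by (intro mult_left_mono) auto
    finally have A: "\<bar>A\<bar> \<le> e / 3 * (2 * h)" .
    have "\<bar>B\<bar> \<le> e / 3 * norm (s *\<^sub>R a)"
      using d(2)[of "x + s *\<^sub>R a"] n2 h unfolding B_def by simp
    also have "\<dots> \<le> e / 3 * h" using n2 e by (intro mult_left_mono) auto
    finally have B: "\<bar>B\<bar> \<le> e / 3 * h" .
    have "F' (s *\<^sub>R a + h *\<^sub>R b) = F' (s *\<^sub>R a) + h * F' b"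
      by (simp add: linear_add[OF lin] linear_scale[OF lin])
    then have "\<psi> h - \<psi> 0 - h\<^sup>2 * F' b = h * (A - B)"
      unfolding mv A_def B_def by (simp add: algebra_simps power2_eq_square)
    moreover have "\<bar>h * (A - B)\<bar> \<le> h * (e * h)"
      unfolding abs_mult using A B h by (intro mult_mono) auto
    ultimately show ?thesis unfolding \<psi>_def by (simp add: algebra_simps power2_eq_square)
  qed
  show ?thesis unfolding L
    by (rule exI[of _ "min d r / 2"]) (use d(1) r(1) main in \<open>auto simp: a_def b_def\<close>)
qed

text \<open>The second difference is symmetric in the two directions, so after division by
  \<open>h\<^sup>2\<close> it approximates both mixed derivatives.\<close>

lemma pderiv_at_commute:
  fixes f :: "real ^ 'n::finite \<Rightarrow> real"
  assumes U: "open U" "x \<in> U" and f: "\<And>y. y \<in> U \<Longrightarrow> f differentiable at y"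
    and F: "\<And>i. pderiv_at i f differentiable at x"
  shows "pderiv_at i (pderiv_at j f) x = pderiv_at j (pderiv_at i f) x"
proof (rule ccontr)
  define P Q where "P = pderiv_at i (pderiv_at j f) x" and "Q = pderiv_at j (pderiv_at i f) x"
  assume "\<not> ?thesis"
  \<comment> \<open>With a third of the gap as tolerance, the two estimates bound the gap by two
    thirds of itself.\<close>
  then have e: "0 < \<bar>P - Q\<bar> / 3" unfolding P_def Q_def by simp
  define D where "D h = f (x + h *\<^sub>R axis i 1 + h *\<^sub>R axis j 1) - f (x + h *\<^sub>R axis i 1) - f (x + h *\<^sub>R axis j 1) + f x" for h
  obtain d1 where d1: "d1 > 0" "\<And>h. 0 < h \<Longrightarrow> h < d1 \<Longrightarrow> \<bar>D h - h\<^sup>2 * Q\<bar> \<le> \<bar>P - Q\<bar> / 3 * h\<^sup>2"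
    using second_difference_estimate[OF U f F e, of i j] unfolding D_def Q_def by blast
  have D: "D h = f (x + h *\<^sub>R axis j 1 + h *\<^sub>R axis i 1) - f (x + h *\<^sub>R axis j 1) - f (x + h *\<^sub>R axis i 1) + f x" for h
  proof -
    have "x + h *\<^sub>R axis i 1 + h *\<^sub>R axis j 1 = x + h *\<^sub>R axis j 1 + h *\<^sub>R axis i 1"
      by (simp add: ac_simps)
    then show ?thesis unfolding D_def by (simp only:)
  qed
  obtain d2 where d2: "d2 > 0" "\<And>h. 0 < h \<Longrightarrow> h < d2 \<Longrightarrow> \<bar>D h - h\<^sup>2 * P\<bar> \<le> \<bar>P - Q\<bar> / 3 * h\<^sup>2"
    using second_difference_estimate[OF U f F e, of j i] unfolding D P_def by blast
  define h where "h = min d1 d2 / 2"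
  have h: "0 < h" "h < d1" "h < d2" using d1(1) d2(1) unfolding h_def by auto
  have "h\<^sup>2 * \<bar>P - Q\<bar> = \<bar>(D h - h\<^sup>2 * Q) - (D h - h\<^sup>2 * P)\<bar>"
  proof -
    have "(D h - h\<^sup>2 * Q) - (D h - h\<^sup>2 * P) = h\<^sup>2 * (P - Q)" by (simp add: algebra_simps)
    then show ?thesis by (simp add: abs_mult)
  qed
  also have "\<dots> \<le> \<bar>P - Q\<bar> / 3 * h\<^sup>2 + \<bar>P - Q\<bar> / 3 * h\<^sup>2"
    using d1(2)[OF h(1,2)] d2(2)[OF h(1,3)] by linarith
  finally have "h\<^sup>2 * \<bar>P - Q\<bar> \<le> 0" by (simp add: mult.commute)
  then show False using h e by (simp add: mult_le_0_iff)
qed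

section \<open>Differentiability of inverse matrices and openness of invertibility\<close>

lemma matrix_inv_inverse:
  fixes B :: "real ^ 'n::finite ^ 'n"
  assumes "invertible B"
  shows "B ** matrix_inv B = mat 1" "matrix_inv B ** B = mat 1"
  using someI_ex[OF assms[unfolded invertible_def]] unfolding matrix_inv_def by auto

text \<open>Cramer's rule. It makes each entry of the inverse a quotient of determinants, so its
  differentiability reduces to that of \<open>det\<close>.\<close>

lemma matrix_inv_entry:
  fixes B :: "real ^ 'n::finite ^ 'n"
  assumes "invertible B"
  shows "matrix_inv B $ k $ l = det (\<chi> i j. if j = k then axis l 1 $ i else B $ i $ j) / det B"
proof -
  have e: "B *v (matrix_inv B *v axis l 1) = axis l 1"
    by (simp add: matrix_vector_mul_assoc matrix_inv_inverse[OF assms])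
  have d: "det B \<noteq> 0" using assms invertible_det_nz by blast
  have "matrix_inv B *v axis l 1 = (\<chi> k. det (\<chi> i j. if j = k then axis l 1 $ i else B $ i $ j) / det B)"
    by (rule iffD1[OF cramer[OF d] e])
  moreover have "(matrix_inv B *v axis l 1) $ k = matrix_inv B $ k $ l"
    by (simp add: matrix_vector_mul_component inner_axis)
  ultimately show ?thesis by simp
qed

lemma differentiable_det:
  fixes G :: "'b::real_normed_vector \<Rightarrow> real ^ 'n::finite ^ 'n"
  assumes "\<And>i j. (\<lambda>y. G y $ i $ j) differentiable at x"
  shows "(\<lambda>y. det (G y)) differentiable at x"
proof -
  have "(\<lambda>y. \<Prod>i\<in>UNIV. G y $ i $ p i) differentiable at x" for p
  proof -
    have "((\<lambda>y. G y $ i $ p i) has_derivative frechet_derivative (\<lambda>y. G y $ i $ p i) (at x)) (at x)" for i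
      using assms frechet_derivative_works by blast
    then show ?thesis unfolding differentiable_def by (intro exI, rule has_derivative_prod)
  qed
  then show ?thesis unfolding det_def by (intro differentiable_sum differentiable_mult differentiable_const) auto
qed

text \<open>Used to shrink a chart: invertibility is established at one point, and continuity of the
  determinant spreads it to a neighbourhood.\<close>

lemma open_invertible:
  fixes G :: "'b::real_normed_vector \<Rightarrow> real ^ 'n::finite ^ 'n"
  assumes U: "open U" "x \<in> U" and G: "\<And>y i j. y \<in> U \<Longrightarrow> (\<lambda>y. G y $ i $ j) differentiable at y"
    and inv: "invertible (G x)"
  shows "\<exists>V. open V \<and> x \<in> V \<and> V \<subseteq> U \<and> (\<forall>y\<in>V. invertible (G y))"
proof -
  have "continuous_on U (\<lambda>y. det (G y))"
    by (intro differentiable_imp_continuous_on differentiable_at_imp_differentiable_on differentiable_det G)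
  then have "open {y \<in> U. det (G y) \<in> - {0}}"
    using continuous_open_preimage[OF _ U(1), of "\<lambda>y. det (G y)" "- {0}"]
    by (simp add: vimage_def Int_def open_Compl)
  then show ?thesis using U inv unfolding invertible_det_nz
    by (intro exI[of _ "{y \<in> U. det (G y) \<in> - {0}}"]) auto
qed

lemma differentiable_matrix_inv:
  fixes G :: "'b::real_normed_vector \<Rightarrow> real ^ 'n::finite ^ 'n"
  assumes U: "open U" "x \<in> U" and G: "\<And>i j. (\<lambda>y. G y $ i $ j) differentiable at x"
    and inv: "\<And>y. y \<in> U \<Longrightarrow> invertible (G y)"
  shows "(\<lambda>y. matrix_inv (G y) $ k $ l) differentiable at x"
proof -
  have "(\<lambda>y. det (\<chi> i j. if j = k then axis l 1 $ i else G y $ i $ j) / det (G y)) differentiable at x"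
  proof (rule differentiable_divide)
    show "(\<lambda>y. det (\<chi> i j. if j = k then axis l 1 $ i else G y $ i $ j)) differentiable at x"
    proof (rule differentiable_det)
      show "(\<lambda>y. (\<chi> i j. if j = k then axis l 1 $ i else G y $ i $ j) $ i $ j) differentiable at x" for i j
        by (cases "j = k") (auto simp: G)
    qed
    show "(\<lambda>y. det (G y)) differentiable at x" by (rule differentiable_det) (rule G)
    show "det (G x) \<noteq> 0" using inv U invertible_det_nz by blast
  qed
  then show ?thesis
    by (rule differentiable_cong_open[OF U, rotated]) (simp add: matrix_inv_entry inv)
qed

section \<open>Simultaneous diagonalization\<close>

lemma nonneg_quadratic_imp_linear_coeff_zero:
  fixes a c :: real
  assumes "\<And>s. 0 \<le> 2 * s * a + s\<^sup>2 * c"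
  shows "a = 0"
proof -
  \<comment> \<open>Any positive \<open>d\<close> above \<open>c\<close> would do: at
    \<open>s = - a / d\<close> the quadratic equals \<open>(a / d)\<^sup>2 * (c - 2 * d)\<close>,
    whose second factor is negative.\<close>
  define d where "d = \<bar>c\<bar> + 1"
  have d: "c < d" "0 < d" unfolding d_def by auto
  have "0 \<le> 2 * (- a / d) * a + (- a / d)\<^sup>2 * c" by (rule assms)
  also have "\<dots> = (a / d)\<^sup>2 * (c - 2 * d)"
    using d by (simp add: field_simps power2_eq_square)
  finally have "0 \<le> (a / d)\<^sup>2 * (c - 2 * d)" .
  then have "a / d = 0" using d by (auto simp: zero_le_mult_iff)
  then show ?thesis using d by simp
qed

text \<open>A minimizer of the Rayleigh quotient Q / b on \<open>V\<close> is an eigenvector, and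
  induction continues on its \<open>b\<close>-orthogonal complement in \<open>V\<close>. The
  eigenvector equation is tested only against \<open>V\<close>, because the form need not come from
  an operator that preserves \<open>V\<close>.\<close>

lemma simultaneous_diagonalization:
  fixes b Q :: "'a::euclidean_space \<Rightarrow> 'a \<Rightarrow> real"
  assumes b: "bilinear b" and bs: "\<And>x y. b x y = b y x" and bp: "\<And>x. x \<noteq> 0 \<Longrightarrow> 0 < b x x"
    and Q: "bilinear Q" and Qs: "\<And>x y. Q x y = Q y x" and V: "subspace V"
  shows "\<exists>B\<subseteq>V. independent B \<and> card B = dim V \<and> (\<forall>w\<in>B. \<exists>\<mu>. \<forall>t\<in>V. Q w t = \<mu> * b w t)"
  using V
proof (induction "dim V" arbitrary: V)
  case 0
  then show ?case by (intro exI[of _ "{}"]) (auto simp: independent_empty)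
next
  case (Suc k)
  note bi = bilinear_ladd[OF b] bilinear_radd[OF b] bilinear_lmul[OF b] bilinear_rmul[OF b]
  note Qi = bilinear_ladd[OF Q] bilinear_radd[OF Q] bilinear_lmul[OF Q] bilinear_rmul[OF Q]
  obtain x0 where x0: "x0 \<in> V" "x0 \<noteq> 0"
  proof -
    have "\<not> V \<subseteq> {0}" using Suc.hyps(2) by (metis dim_eq_0 nat.distinct(1))
    then show ?thesis using that by blast
  qed
  \<comment> \<open>The Euclidean unit sphere is compact at once; the quotient is invariant under
    scaling, so normalizing by \<open>b\<close> instead would give the same minimum.\<close>
  define K where "K = V \<inter> sphere 0 1"
  have "compact K" unfolding K_def
    by (intro closed_Int_compact closed_subspace Suc.prems compact_sphere)
  moreover have "x0 /\<^sub>R norm x0 \<in> K" unfolding K_def using x0 Suc.prems by (auto simp: subspace_scale)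
  moreover have "continuous_on K (\<lambda>x. Q x x / b x x)"
  proof (intro continuous_on_divide ballI)
    show "continuous_on K (\<lambda>x. Q x x)"
      using bounded_bilinear.continuous_on[OF Q[unfolded bilinear_conv_bounded_bilinear]] continuous_on_id by blast
    show "continuous_on K (\<lambda>x. b x x)"
      using bounded_bilinear.continuous_on[OF b[unfolded bilinear_conv_bounded_bilinear]] continuous_on_id by blast
    fix x assume "x \<in> K"
    then have "x \<noteq> 0" unfolding K_def by auto
    then show "b x x \<noteq> 0" using bp by (metis less_irrefl)
  qed
  ultimately obtain w where w: "w \<in> K" and min: "\<And>y. y \<in> K \<Longrightarrow> Q w w / b w w \<le> Q y y / b y y"
    using continuous_attains_inf[of K "\<lambda>x. Q x x / b x x"] by blast
  define \<mu> where "\<mu> = Q w w / b w w"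
  have wV: "w \<in> V" and w0: "w \<noteq> 0" using w unfolding K_def by auto
  have bw: "0 < b w w" using bp w0 .
  have nonneg: "0 \<le> Q x x - \<mu> * b x x" if "x \<in> V" for x
  proof (cases "x = 0")
    case True
    then show ?thesis using bilinear_lzero[OF Q] bilinear_lzero[OF b] by simp
  next
    case False
    have "x /\<^sub>R norm x \<in> K" unfolding K_def using that False Suc.prems by (auto simp: subspace_scale)
    from min[OF this] have "\<mu> \<le> Q x x / b x x"
      using False unfolding \<mu>_def by (simp add: bi Qi)
    then show ?thesis using bp[OF False] by (simp add: field_simps)
  qed
  \<comment> \<open>First variation: the form Q - \<mu> b is nonnegative on \<open>V\<close> and
    vanishes at \<open>w\<close>, so its linear term at \<open>w\<close> in every direction
    \<open>t\<close> is zero.\<close>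
  have wt: "Q w t = \<mu> * b w t" if t: "t \<in> V" for t
  proof -
    have "0 \<le> 2 * s * (Q w t - \<mu> * b w t) + s\<^sup>2 * (Q t t - \<mu> * b t t)" for s
    proof -
      have "0 \<le> Q (w + s *\<^sub>R t) (w + s *\<^sub>R t) - \<mu> * b (w + s *\<^sub>R t) (w + s *\<^sub>R t)"
        using nonneg wV t Suc.prems by (simp add: subspace_add subspace_scale)
      also have "\<dots> = (Q w w - \<mu> * b w w) + 2 * s * (Q w t - \<mu> * b w t) + s\<^sup>2 * (Q t t - \<mu> * b t t)"
        by (simp add: bi Qi Qs[of t w] bs[of t w] algebra_simps power2_eq_square)
      also have "Q w w - \<mu> * b w w = 0" using bw unfolding \<mu>_def by simp
      finally show ?thesis by simp
    qed
    then have "Q w t - \<mu> * b w t = 0" by (rule nonneg_quadratic_imp_linear_coeff_zero)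
    then show ?thesis by simp
  qed
  define V' where "V' = {x \<in> V. b w x = 0}"
  have sV': "subspace V'"
    using Suc.prems bilinear_rzero[OF b] unfolding V'_def subspace_def by (auto simp: bi)
  have wn: "w \<notin> V'" using bw unfolding V'_def by auto
  have decomp: "\<exists>\<alpha>. \<exists>t'\<in>V'. t = \<alpha> *\<^sub>R w + t'" if t: "t \<in> V" for t
  proof -
    define \<alpha> where "\<alpha> = b w t / b w w"
    have "b w (t - \<alpha> *\<^sub>R w) = 0" using bw by (simp add: bilinear_rsub[OF b] bi \<alpha>_def)
    then have "t - \<alpha> *\<^sub>R w \<in> V'"
      using t wV Suc.prems unfolding V'_def by (simp add: subspace_diff subspace_scale)
    moreover have "t = \<alpha> *\<^sub>R w + (t - \<alpha> *\<^sub>R w)" by simp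
    ultimately show ?thesis by blast
  qed
  have "span (insert w V') = V"
  proof
    show "span (insert w V') \<subseteq> V"
      using wV Suc.prems by (intro span_minimal) (auto simp: V'_def)
    show "V \<subseteq> span (insert w V')"
    proof
      fix t assume "t \<in> V"
      from decomp[OF this] obtain \<alpha> t' where "t' \<in> V'" "t = \<alpha> *\<^sub>R w + t'" by blast
      then show "t \<in> span (insert w V')"
        by (simp add: span_add span_base span_scale)
    qed
  qed
  then have "dim V = dim (insert w V')" using dim_span by metis
  also have "\<dots> = dim V' + 1" using wn sV' by (simp add: dim_insert span_eq_iff[THEN iffD2])
  finally have dV': "k = dim V'" using Suc.hyps(2) by simp
  obtain B' where B': "B' \<subseteq> V'" "independent B'" "card B' = dim V'"
    and ev: "\<And>w'. w' \<in> B' \<Longrightarrow> \<exists>\<mu>. \<forall>t\<in>V'. Q w' t = \<mu> * b w' t"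
    using Suc.hyps(1)[OF dV' sV'] by blast
  have "span B' \<subseteq> V'" using B'(1) sV' by (rule span_minimal)
  then have wB: "w \<notin> span B'" using wn by blast
  then have wB': "w \<notin> B'" using span_base by blast
  have "independent (insert w B')" using B'(2) wB by (simp add: independent_insert)
  moreover have "card (insert w B') = dim V"
    using wB' B'(3) dV' Suc.hyps(2) independent_imp_finite[OF B'(2)] by simp
  moreover have "insert w B' \<subseteq> V" using wV B'(1) unfolding V'_def by auto
  moreover have "\<exists>\<mu>. \<forall>t\<in>V. Q w' t = \<mu> * b w' t" if w': "w' \<in> insert w B'" for w'
  proof (cases "w' = w")
    case True
    then show ?thesis using wt by blast
  next
    case False
    then have w'B: "w' \<in> B'" using w' by simp
    then have w'V: "w' \<in> V" "b w w' = 0" using B'(1) unfolding V'_def by auto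
    obtain \<nu> where \<nu>: "\<forall>t\<in>V'. Q w' t = \<nu> * b w' t" using ev[OF w'B] by blast
    have "Q w' t = \<nu> * b w' t" if "t \<in> V" for t
    proof -
      obtain \<alpha> t' where t': "t' \<in> V'" "t = \<alpha> *\<^sub>R w + t'" using decomp[OF \<open>t \<in> V\<close>] by blast
      \<comment> \<open>The inductive equation for \<open>w'\<close> holds only against
        \<open>V'\<close>. It extends to the missing direction \<open>w\<close> because both sides
        vanish there, the left one by the eigenvector equation of \<open>w\<close> and
        symmetry.\<close>
      have "Q w' w = 0" using wt[OF w'V(1)] w'V(2) Qs[of w' w] by simp
      moreover have "b w' w = 0" using w'V(2) bs[of w' w] by simp
      ultimately show ?thesis using \<nu> t' by (simp add: bi Qi)
    qed
    then show ?thesis by blast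
  qed
  ultimately show ?case by blast
qed

text \<open>Riesz representation for \<open>b\<close>: positivity makes the map to coefficient
  vectors injective, hence surjective in finite dimension.\<close>

lemma bilinear_representation:
  fixes b :: "real ^ 'n::finite \<Rightarrow> real ^ 'n \<Rightarrow> real"
  assumes b: "bilinear b" and bp: "\<And>x. x \<noteq> 0 \<Longrightarrow> 0 < b x x" and f: "linear f"
  shows "\<exists>u. \<forall>t. f t = b u t"
proof -
  define L where "L x = (\<chi> i. b x (axis i 1))" for x
  have exp: "f t = (\<Sum>i\<in>UNIV. t $ i * f (axis i 1))" if "linear f" for f :: "real ^ 'n \<Rightarrow> real" and t
  proof -
    have "f t = f (\<Sum>i\<in>UNIV. t $ i *\<^sub>R axis i 1)"
      by (metis (no_types) basis_expansion scalar_mult_eq_scaleR)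
    then show ?thesis by (simp add: linear_sum[OF that] linear_scale[OF that])
  qed
  have lin: "linear L" unfolding L_def
    by (rule linearI) (simp_all add: vec_eq_iff bilinear_ladd[OF b] bilinear_lmul[OF b])
  have br: "linear (b x)" for x using b unfolding bilinear_def by blast
  have "x = 0" if "L x = 0" for x
  proof (rule ccontr)
    assume "x \<noteq> 0"
    moreover have "b x (axis i 1) = 0" for i using arg_cong[OF that, of "\<lambda>y. y $ i"] unfolding L_def by simp
    then have "b x x = 0" by (subst exp[OF br]) simp
    ultimately show False using bp by fastforce
  qed
  then have "inj L" using lin linear_injective_0 by blast
  then have "surj L" using lin linear_injective_imp_surjective by blast
  then obtain u where "L u = (\<chi> i. f (axis i 1))" by (metis surj_def)
  then have "b u (axis i 1) = f (axis i 1)" for i unfolding L_def by (simp add: vec_eq_iff)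
  then have "f t = b u t" for t by (subst exp[OF f], subst exp[OF br]) simp
  then show ?thesis by blast
qed

section \<open>Contractions and the algebra of the Weyl tensor\<close>

text \<open>Tensors appear as component arrays. Evaluating them on vectors turns index symmetries
  into permutations of arguments and orthogonality into vanishing factors.\<close>

definition contract1 :: "('n::finite \<Rightarrow> real) \<Rightarrow> real ^ 'n \<Rightarrow> real"
  where "contract1 f x = (\<Sum>i\<in>UNIV. f i * x $ i)"

definition contract2 :: "('n::finite \<Rightarrow> 'n \<Rightarrow> real) \<Rightarrow> real ^ 'n \<Rightarrow> real ^ 'n \<Rightarrow> real"
  where "contract2 F x y = (\<Sum>i\<in>UNIV. \<Sum>j\<in>UNIV. F i j * x $ i * y $ j)"

definition contract4 :: "('n::finite \<Rightarrow> 'n \<Rightarrow> 'n \<Rightarrow> 'n \<Rightarrow> real) \<Rightarrow>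
    real ^ 'n \<Rightarrow> real ^ 'n \<Rightarrow> real ^ 'n \<Rightarrow> real ^ 'n \<Rightarrow> real"
  where "contract4 R x y z t = (\<Sum>i\<in>UNIV. \<Sum>j\<in>UNIV. \<Sum>k\<in>UNIV. \<Sum>l\<in>UNIV.
    R i j k l * x $ i * y $ j * z $ k * t $ l)"

lemma sum_swap_inner:
  "(\<Sum>i\<in>A. \<Sum>j\<in>B. \<Sum>k\<in>C. f i j k) = (\<Sum>i\<in>A. \<Sum>k\<in>C. \<Sum>j\<in>B. f i j k)"
  by (rule sum.cong[OF refl], rule sum.swap)

lemma contract2_swap: "contract2 (\<lambda>i j. F j i) x y = contract2 F y x"
  unfolding contract2_def by (subst sum.swap) (simp add: mult_ac)

lemma contract4_swap12: "contract4 (\<lambda>i j k l. R j i k l) x y z t = contract4 R y x z t"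
  unfolding contract4_def by (subst sum.swap) (simp add: mult_ac)

lemma contract4_swap34: "contract4 (\<lambda>i j k l. R i j l k) x y z t = contract4 R x y t z"
  unfolding contract4_def
  by (rule sum.cong[OF refl], rule sum.cong[OF refl], subst sum.swap, simp add: mult_ac)

lemma contract4_swap_pairs: "contract4 (\<lambda>i j k l. R k l i j) x y z t = contract4 R z t x y"
proof -
  have "contract4 (\<lambda>i j k l. R k l i j) x y z t =
      (\<Sum>i\<in>UNIV. \<Sum>k\<in>UNIV. \<Sum>j\<in>UNIV. \<Sum>l\<in>UNIV. R k l i j * x $ i * y $ j * z $ k * t $ l)"
    unfolding contract4_def by (rule sum.cong[OF refl], rule sum.swap)
  also have "\<dots> = (\<Sum>k\<in>UNIV. \<Sum>i\<in>UNIV. \<Sum>l\<in>UNIV. \<Sum>j\<in>UNIV. R k l i j * x $ i * y $ j * z $ k * t $ l)"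
    by (subst sum.swap) (rule sum.cong[OF refl], rule sum.cong[OF refl], rule sum.swap)
  also have "\<dots> = (\<Sum>k\<in>UNIV. \<Sum>l\<in>UNIV. \<Sum>i\<in>UNIV. \<Sum>j\<in>UNIV. R k l i j * x $ i * y $ j * z $ k * t $ l)"
    by (rule sum.cong[OF refl], rule sum.swap)
  also have "\<dots> = contract4 R z t x y"
    unfolding contract4_def by (intro sum.cong refl) (simp add: mult_ac)
  finally show ?thesis .
qed

lemma contract4_diff: "contract4 (\<lambda>i j k l. R i j k l - S i j k l) x y z t = contract4 R x y z t - contract4 S x y z t"
  unfolding contract4_def by (simp add: algebra_simps sum_subtractf)

lemma contract4_neg: "contract4 (\<lambda>i j k l. - R i j k l) x y z t = - contract4 R x y z t"
  unfolding contract4_def by (simp add: sum_negf)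

lemma contract4_add: "contract4 (\<lambda>i j k l. R i j k l + S i j k l) x y z t = contract4 R x y z t + contract4 S x y z t"
  unfolding contract4_def by (simp add: algebra_simps sum.distrib)

lemma contract4_prod: "contract4 (\<lambda>i j k l. F i k * H j l) x y z t = contract2 F x z * contract2 H y t"
proof -
  have "contract2 F x z * contract2 H y t = (\<Sum>i\<in>UNIV. \<Sum>j\<in>UNIV.
      (\<Sum>k\<in>UNIV. F i k * x $ i * z $ k) * (\<Sum>l\<in>UNIV. H j l * y $ j * t $ l))"
    unfolding contract2_def by (rule sum_product)
  also have "\<dots> = contract4 (\<lambda>i j k l. F i k * H j l) x y z t"
    unfolding contract4_def sum_product by (intro sum.cong refl) (simp add: mult_ac)
  finally show ?thesis by simp
qed

lemma contract4_kulkarni_nomizu: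
  "contract4 (kulkarni_nomizu s h) x y z t =
    contract2 s x z * contract2 h y t + contract2 h x z * contract2 s y t - contract2 s x t * contract2 h y z - contract2 s y z * contract2 h x t"
proof -
  have "contract4 (kulkarni_nomizu s h) x y z t =
     contract4 (\<lambda>i j k l. s i k * h j l) x y z t + contract4 (\<lambda>i j k l. h i k * s j l) x y z t
     - contract4 (\<lambda>i j k l. s i l * h j k) x y z t - contract4 (\<lambda>i j k l. h i l * s j k) x y z t"
    unfolding kulkarni_nomizu_def contract4_diff contract4_add by (simp add: mult.commute)
  also have "contract4 (\<lambda>i j k l. s i l * h j k) x y z t = contract2 s x t * contract2 h y z"
    using contract4_swap34[of "\<lambda>i j k l. s i k * h j l" x y z t] contract4_prod[of s h x y t z] by simp
  also have "contract4 (\<lambda>i j k l. h i l * s j k) x y z t = contract2 h x t * contract2 s y z"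
    using contract4_swap34[of "\<lambda>i j k l. h i k * s j l" x y z t] contract4_prod[of h s x y t z] by simp
  finally show ?thesis by (simp add: contract4_prod)
qed

lemma contract2_linear_combination:
  "contract2 (\<lambda>i j. c * (F i j - d * H i j)) x y = c * (contract2 F x y - d * contract2 H x y)"
  unfolding contract2_def by (simp add: algebra_simps sum_subtractf sum_distrib_left)

text \<open>This is a Jacobi-type form of \<open>v\<close>; for the Weyl tensor it is the form
  diagonalized on the complement of \<open>v\<close>.\<close>

lemma bilinear_contract4_sandwich: "bilinear (\<lambda>w t. contract4 R v w v t)"
  unfolding bilinear_def
  by (intro conjI allI linearI)
    (simp_all add: contract4_def algebra_simps sum.distrib sum_distrib_left)

text \<open>The hypothesis \<open>main\<close> is the shape that \<open>R\<^bsub>ijkl\<^esub>X\<^sup>j\<close> takes when \<open>X\<close> is parallel for a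
  conformally related metric. On \<open>X\<^sup>\<bottom>\<close> it determines \<open>Ric(X, \<sqdot>)\<close>, hence exactly the part of the
  Schouten tensor that enters \<open>W(\<sqdot>, X, \<sqdot>, \<sqdot>)\<close> there.\<close>

lemma weyl_contraction_eq_zero:
  fixes G H :: "real ^ 'n::finite ^ 'n" and X :: "real ^ 'n"
  assumes G: "\<And>i j. G $ i $ j = G $ j $ i" and GH: "G ** H = mat 1" and HG: "H ** G = mat 1"
    and anti: "\<And>i j k l. R i j k l = - R j i k l"
    and xi: "\<And>i. \<xi> i = (\<Sum>j\<in>UNIV. G $ i $ j * X $ j)" and N: "contract1 \<xi> X \<noteq> 0"
    and main: "\<And>i k l. (\<Sum>j\<in>UNIV. R i j k l * X $ j) =
      a k * G $ i $ l - a l * G $ i $ k + m k l * \<xi> i + \<xi> k * P l i - \<xi> l * P k i"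
    and Ric: "\<And>j l. Ric j l = (\<Sum>i\<in>UNIV. \<Sum>k\<in>UNIV. H $ i $ k * R i j k l)"
    and S: "\<And>i j. S i j = 1 / (real CARD('n) - 2) * (Ric i j - s * G $ i $ j)"
    and n: "CARD('n) \<noteq> 2"
    and w: "contract1 \<xi> w = 0" and z: "contract1 \<xi> z = 0" and t: "contract1 \<xi> t = 0"
  shows "contract4 (\<lambda>i j k l. R i j k l - kulkarni_nomizu S (\<lambda>a b. G $ a $ b) i j k l) w X z t = 0"
proof -
  let ?G = "\<lambda>a b. G $ a $ b"
  have R: "contract4 R w X z t = contract1 a z * contract2 ?G w t - contract1 a t * contract2 ?G w z + contract2 m z t * contract1 \<xi> w
      + contract1 \<xi> z * contract2 P t w - contract1 \<xi> t * contract2 P z w" for w z t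
  proof -
    have "contract4 R w X z t = (\<Sum>i\<in>UNIV. \<Sum>k\<in>UNIV. \<Sum>l\<in>UNIV. (\<Sum>j\<in>UNIV. R i j k l * X $ j) * w $ i * z $ k * t $ l)"
    proof -
      have "contract4 R w X z t = (\<Sum>i\<in>UNIV. \<Sum>k\<in>UNIV. \<Sum>j\<in>UNIV. \<Sum>l\<in>UNIV. R i j k l * w $ i * X $ j * z $ k * t $ l)"
        unfolding contract4_def by (rule sum.cong[OF refl], rule sum.swap)
      also have "\<dots> = (\<Sum>i\<in>UNIV. \<Sum>k\<in>UNIV. \<Sum>l\<in>UNIV. \<Sum>j\<in>UNIV. R i j k l * w $ i * X $ j * z $ k * t $ l)"
        by (rule sum.cong[OF refl], rule sum.cong[OF refl], rule sum.swap)
      also have "\<dots> = (\<Sum>i\<in>UNIV. \<Sum>k\<in>UNIV. \<Sum>l\<in>UNIV. (\<Sum>j\<in>UNIV. R i j k l * X $ j) * w $ i * z $ k * t $ l)"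
        by (intro sum.cong refl) (simp add: sum_distrib_left sum_distrib_right mult_ac)
      finally show ?thesis .
    qed
    also have "\<dots> =
       (\<Sum>i\<in>UNIV. \<Sum>k\<in>UNIV. \<Sum>l\<in>UNIV. (a k * z $ k) * (G $ i $ l * w $ i * t $ l))
     - (\<Sum>i\<in>UNIV. \<Sum>k\<in>UNIV. \<Sum>l\<in>UNIV. (G $ i $ k * w $ i * z $ k) * (a l * t $ l))
     + (\<Sum>i\<in>UNIV. \<Sum>k\<in>UNIV. \<Sum>l\<in>UNIV. (\<xi> i * w $ i) * (m k l * z $ k * t $ l))
     + (\<Sum>i\<in>UNIV. \<Sum>k\<in>UNIV. \<Sum>l\<in>UNIV. (\<xi> k * z $ k) * (P l i * t $ l * w $ i))
     - (\<Sum>i\<in>UNIV. \<Sum>k\<in>UNIV. \<Sum>l\<in>UNIV. (P k i * z $ k * w $ i) * (\<xi> l * t $ l))"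
      unfolding main by (simp add: algebra_simps sum.distrib sum_subtractf)
    also have "(\<Sum>i\<in>UNIV. \<Sum>k\<in>UNIV. \<Sum>l\<in>UNIV. (a k * z $ k) * (G $ i $ l * w $ i * t $ l)) = contract1 a z * contract2 ?G w t"
      unfolding contract1_def contract2_def
      by (subst sum_swap_inner) (simp add: sum_distrib_left sum_distrib_right mult_ac)
    also have "(\<Sum>i\<in>UNIV. \<Sum>k\<in>UNIV. \<Sum>l\<in>UNIV. (G $ i $ k * w $ i * z $ k) * (a l * t $ l)) = contract1 a t * contract2 ?G w z"
      unfolding contract1_def contract2_def by (simp add: sum_distrib_left sum_distrib_right mult_ac)
    also have "(\<Sum>i\<in>UNIV. \<Sum>k\<in>UNIV. \<Sum>l\<in>UNIV. (\<xi> i * w $ i) * (m k l * z $ k * t $ l)) = contract2 m z t * contract1 \<xi> w"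
      unfolding contract1_def contract2_def
      by (subst sum.swap, subst sum_swap_inner) (simp add: sum_distrib_left sum_distrib_right mult_ac)
    also have "(\<Sum>i\<in>UNIV. \<Sum>k\<in>UNIV. \<Sum>l\<in>UNIV. (\<xi> k * z $ k) * (P l i * t $ l * w $ i)) = contract1 \<xi> z * contract2 P t w"
      unfolding contract2_swap[symmetric, of P] unfolding contract1_def contract2_def
      by (subst sum_swap_inner) (simp add: sum_distrib_left sum_distrib_right mult_ac)
    also have "(\<Sum>i\<in>UNIV. \<Sum>k\<in>UNIV. \<Sum>l\<in>UNIV. (P k i * z $ k * w $ i) * (\<xi> l * t $ l)) = contract1 \<xi> t * contract2 P z w"
      unfolding contract2_swap[symmetric, of P] unfolding contract1_def contract2_def
      by (simp add: sum_distrib_left sum_distrib_right mult_ac)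
    finally show ?thesis .
  qed
  have GX: "contract2 ?G x X = contract1 \<xi> x" for x
    unfolding contract2_def contract1_def xi by (simp add: sum_distrib_left mult_ac)
  have XG: "contract2 ?G X x = contract1 \<xi> x" for x
    using GX[of x] contract2_swap[of ?G X x] G by simp
  \<comment> \<open>Antisymmetry in the first pair forces R(X, X, X, z) = 0. In the formula
    \<open>R\<close> every surviving term then has the factor \<open>contract1 \<xi> X\<close>,
    which is nonzero and cancels.\<close>
  have aX: "contract1 a z = contract2 m X z + contract2 P z X" if z: "contract1 \<xi> z = 0" for z
  proof -
    have "contract4 R X X X z = contract4 (\<lambda>i j k l. - R j i k l) X X X z"
      by (rule arg_cong[where f = "\<lambda>R. contract4 R X X X z"]) (intro ext, rule anti)
    also have "\<dots> = - contract4 (\<lambda>i j k l. R j i k l) X X X z" by (rule contract4_neg)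
    finally have "contract4 R X X X z = 0" unfolding contract4_swap12[of R] by simp
    then have "contract1 \<xi> X * (contract2 m X z + contract2 P z X - contract1 a z) = 0"
      unfolding R by (simp add: XG z algebra_simps)
    then show ?thesis using N by simp
  qed
  have GHc: "(\<Sum>k\<in>UNIV. G $ p $ k * H $ k $ q) = (if p = q then 1 else 0)"
    and HGc: "(\<Sum>k\<in>UNIV. H $ p $ k * G $ k $ q) = (if p = q then 1 else 0)" for p q
    using arg_cong[OF GH, of "\<lambda>B. B $ p $ q"] arg_cong[OF HG, of "\<lambda>B. B $ p $ q"]
    by (simp_all add: matrix_matrix_mult_def mat_def)
  have Hxi: "(\<Sum>k\<in>UNIV. H $ i $ k * \<xi> k) = X $ i" for i
  proof -
    have "(\<Sum>k\<in>UNIV. H $ i $ k * \<xi> k) = (\<Sum>j\<in>UNIV. (\<Sum>k\<in>UNIV. H $ i $ k * G $ k $ j) * X $ j)"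
      unfolding xi sum_distrib_left sum_distrib_right by (subst sum.swap) (simp add: mult_ac)
    then show ?thesis by (simp add: HGc if_distrib[of "\<lambda>a. a * _"] cong: if_cong)
  qed
  have xiH: "(\<Sum>i\<in>UNIV. H $ i $ k * \<xi> i) = X $ k" for k
  proof -
    have "(\<Sum>i\<in>UNIV. H $ i $ k * \<xi> i) = (\<Sum>j\<in>UNIV. (\<Sum>i\<in>UNIV. G $ j $ i * H $ i $ k) * X $ j)"
      unfolding xi sum_distrib_left sum_distrib_right by (subst sum.swap) (simp add: mult_ac G)
    then show ?thesis by (simp add: GHc if_distrib[of "\<lambda>a. a * _"] cong: if_cong)
  qed
  \<comment> \<open>Tracing gives (1 - n) a(z) + m(X, z) + P(z, X), up to a multiple of \<xi>(z) =
    0; by \<open>aX\<close> the last two terms contribute one more a(z).\<close>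
  have RicX: "contract2 Ric X z = (2 - real CARD('n)) * contract1 a z" if z: "contract1 \<xi> z = 0" for z
  proof -
    have T: "(\<Sum>j\<in>UNIV. Ric j l * X $ j) = a l - real CARD('n) * a l + (\<Sum>k\<in>UNIV. m k l * X $ k)
        + (\<Sum>i\<in>UNIV. P l i * X $ i) - \<xi> l * (\<Sum>i\<in>UNIV. \<Sum>k\<in>UNIV. H $ i $ k * P k i)" for l
    proof -
      have "(\<Sum>j\<in>UNIV. Ric j l * X $ j) = (\<Sum>j\<in>UNIV. \<Sum>i\<in>UNIV. \<Sum>k\<in>UNIV. H $ i $ k * R i j k l * X $ j)"
        unfolding Ric by (simp add: sum_distrib_right)
      also have "\<dots> = (\<Sum>i\<in>UNIV. \<Sum>j\<in>UNIV. \<Sum>k\<in>UNIV. H $ i $ k * R i j k l * X $ j)" by (rule sum.swap)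
      also have "\<dots> = (\<Sum>i\<in>UNIV. \<Sum>k\<in>UNIV. \<Sum>j\<in>UNIV. H $ i $ k * R i j k l * X $ j)"
        by (rule sum.cong[OF refl], rule sum.swap)
      also have "\<dots> = (\<Sum>i\<in>UNIV. \<Sum>k\<in>UNIV. H $ i $ k * (\<Sum>j\<in>UNIV. R i j k l * X $ j))"
        by (simp add: sum_distrib_left mult_ac)
      also have "\<dots> = (\<Sum>i\<in>UNIV. \<Sum>k\<in>UNIV. H $ i $ k * (a k * G $ i $ l)) - (\<Sum>i\<in>UNIV. \<Sum>k\<in>UNIV. H $ i $ k * (a l * G $ i $ k))
          + (\<Sum>i\<in>UNIV. \<Sum>k\<in>UNIV. H $ i $ k * (m k l * \<xi> i)) + (\<Sum>i\<in>UNIV. \<Sum>k\<in>UNIV. H $ i $ k * (\<xi> k * P l i))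
          - (\<Sum>i\<in>UNIV. \<Sum>k\<in>UNIV. H $ i $ k * (\<xi> l * P k i))"
        by (simp add: main distrib_left right_diff_distrib sum.distrib sum_subtractf)
      also have "(\<Sum>i\<in>UNIV. \<Sum>k\<in>UNIV. H $ i $ k * (a k * G $ i $ l)) = (\<Sum>k\<in>UNIV. (\<Sum>i\<in>UNIV. G $ l $ i * H $ i $ k) * a k)"
        by (subst sum.swap) (simp add: sum_distrib_left sum_distrib_right mult_ac G[of l])
      also have "\<dots> = a l" by (simp add: GHc if_distrib[of "\<lambda>a. a * _"] cong: if_cong)
      also have "(\<Sum>i\<in>UNIV. \<Sum>k\<in>UNIV. H $ i $ k * (a l * G $ i $ k)) = (\<Sum>i\<in>UNIV. (\<Sum>k\<in>UNIV. H $ i $ k * G $ k $ i) * a l)"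
        unfolding sum_distrib_right by (intro sum.cong refl) (subst G, simp)
      also have "\<dots> = real CARD('n) * a l" by (simp add: HGc)
      also have "(\<Sum>i\<in>UNIV. \<Sum>k\<in>UNIV. H $ i $ k * (m k l * \<xi> i)) = (\<Sum>k\<in>UNIV. m k l * (\<Sum>i\<in>UNIV. H $ i $ k * \<xi> i))"
        by (subst sum.swap) (simp add: sum_distrib_left mult_ac)
      also have "(\<Sum>i\<in>UNIV. \<Sum>k\<in>UNIV. H $ i $ k * (\<xi> k * P l i)) = (\<Sum>i\<in>UNIV. P l i * (\<Sum>k\<in>UNIV. H $ i $ k * \<xi> k))"
        by (simp add: sum_distrib_left mult_ac)
      also have "(\<Sum>i\<in>UNIV. \<Sum>k\<in>UNIV. H $ i $ k * (\<xi> l * P k i)) = \<xi> l * (\<Sum>i\<in>UNIV. \<Sum>k\<in>UNIV. H $ i $ k * P k i)"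
        by (simp add: sum_distrib_left mult_ac)
      finally show ?thesis by (simp only: xiH Hxi)
    qed
    have "contract2 Ric X z = (\<Sum>l\<in>UNIV. (\<Sum>j\<in>UNIV. Ric j l * X $ j) * z $ l)"
      unfolding contract2_def by (subst sum.swap) (simp add: sum_distrib_right)
    also have "\<dots> = contract1 a z - real CARD('n) * contract1 a z + contract2 m X z + contract2 P z X
        - contract1 \<xi> z * (\<Sum>i\<in>UNIV. \<Sum>k\<in>UNIV. H $ i $ k * P k i)"
    proof -
      have 1: "contract2 m X z = contract1 (\<lambda>l. \<Sum>k\<in>UNIV. m k l * X $ k) z"
        unfolding contract2_def contract1_def by (subst sum.swap) (simp add: sum_distrib_right)
      have 2: "contract2 P z X = contract1 (\<lambda>l. \<Sum>i\<in>UNIV. P l i * X $ i) z"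
        unfolding contract2_def contract1_def by (simp add: sum_distrib_left sum_distrib_right mult_ac)
      have 3: "(\<Sum>l\<in>UNIV. (a l - c * a l + M l + Q l - \<xi> l * K) * z $ l) =
          contract1 a z - c * contract1 a z + contract1 M z + contract1 Q z - contract1 \<xi> z * K" for c M Q K
        unfolding contract1_def by (simp add: algebra_simps sum.distrib sum_subtractf sum_distrib_left)
      show ?thesis unfolding T 1 2 by (rule 3)
    qed
    finally show ?thesis using aX[OF z] z by (simp add: algebra_simps)
  qed
  \<comment> \<open>The scalar curvature part is a multiple of G(X, z) = 0, so only the Ricci part
    remains.\<close>
  have SX: "contract2 S X z = - contract1 a z" if z: "contract1 \<xi> z = 0" for z
  proof -
    have "S = (\<lambda>i j. 1 / (real CARD('n) - 2) * (Ric i j - s * G $ i $ j))" by (intro ext) (rule S)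
    then have "contract2 S X z = 1 / (real CARD('n) - 2) * (contract2 Ric X z - s * contract2 ?G X z)"
      by (simp only: contract2_linear_combination)
    also have "\<dots> = 1 / (real CARD('n) - 2) * ((2 - real CARD('n)) * contract1 a z)"
      by (simp add: RicX[OF z] XG z)
    also have "2 - real CARD('n) = - (real CARD('n) - 2)" by simp
    also have "1 / (real CARD('n) - 2) * (- (real CARD('n) - 2) * contract1 a z) = - contract1 a z"
    proof -
      have "1 / c * (- c * x) = - x" if "c \<noteq> 0" for c x :: real using that by simp
      then show ?thesis using n by (metis eq_iff_diff_eq_0 of_nat_eq_iff of_nat_numeral)
    qed
    finally show ?thesis .
  qed
  \<comment> \<open>In the Kulkarni-Nomizu product at (w, X, z, t) the terms with G(X, z) or G(X, t)
    vanish; by \<open>SX\<close> the other two equal a(z) G(w, t) - a(t) G(w, z), which is what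
    remains of \<open>R\<close>.\<close>
  show ?thesis
    unfolding contract4_diff contract4_kulkarni_nomizu R by (simp add: XG w z t SX)
qed

section \<open>Bivectors and the Weyl operator\<close>

lemma linear_matrix_sandwich:
  fixes B :: "real ^ 'm ^ 'k::finite" and C :: "real ^ 'l::finite ^ 'n"
  shows "linear (\<lambda>M :: real ^ 'n::finite ^ 'm::finite. B ** M ** C)"
  by (rule linearI)
    (simp_all add: matrix_matrix_mult_def vec_eq_iff algebra_simps sum.distrib sum_distrib_left)

lemma transpose_sandwich:
  fixes C M :: "real ^ 'n::finite ^ 'n"
  assumes "transpose M = - M"
  shows "transpose (transpose C ** M ** C) = - (transpose C ** M ** C)"
proof -
  have "transpose (transpose C ** M ** C) = transpose C ** (- M) ** C"
    by (simp only: matrix_transpose_mul transpose_transpose assms matrix_mul_assoc)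
  then show ?thesis using linear_neg[OF linear_matrix_sandwich] by metis
qed

lemma linear_wedge: "linear (wedge v)"
  by (rule linearI) (simp_all add: wedge_def vec_eq_iff algebra_simps)

lemma wedge_in_bivectors: "wedge x y \<in> bivectors"
  unfolding bivectors_def wedge_def by simp

lemma mem_bivectors_iff: "\<omega> \<in> bivectors \<longleftrightarrow> transpose \<omega> = - \<omega>"
  unfolding bivectors_def transpose_def vec_eq_iff
  by (simp only: mem_Collect_eq vec_lambda_beta vector_uminus_component) blast

lemma subspace_bivectors: "subspace (bivectors :: (real ^ 'n ^ 'n) set)"
proof -
  have "linear (\<lambda>\<omega> :: real ^ 'n ^ 'n. \<omega> + transpose \<omega>)"
    by (rule linearI) (simp_all add: transpose_def vec_eq_iff algebra_simps)
  from linear_subspace_kernel[OF this]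
  show ?thesis unfolding bivectors_def by (simp add: vec_eq_iff transpose_def eq_neg_iff_add_eq_0)
qed

lemma bivector_inner_diff:
  "bivector_inner b (\<omega> - \<eta>) \<zeta> = bivector_inner b \<omega> \<zeta> - bivector_inner b \<eta> \<zeta>"
  unfolding bivector_inner_def by (simp add: algebra_simps sum_subtractf diff_divide_distrib)

lemma linear_bivector_inner: "linear (bivector_inner b \<omega>)"
  by (rule linearI)
    (simp_all add: bivector_inner_def algebra_simps sum.distrib add_divide_distrib sum_distrib_left)

definition gram :: "(real ^ 'n::finite \<Rightarrow> real ^ 'n \<Rightarrow> real) \<Rightarrow> real ^ 'n ^ 'n"
  where "gram b = (\<chi> i j. b (axis i 1) (axis j 1))"

lemma contract2_gram:
  assumes "bilinear b"
  shows "contract2 (\<lambda>i j. gram b $ i $ j) x y = b x y"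
proof -
  have "b x y = b (\<Sum>i\<in>UNIV. x $ i *\<^sub>R axis i 1) (\<Sum>k\<in>UNIV. y $ k *\<^sub>R axis k 1)"
    by (metis (no_types) basis_expansion scalar_mult_eq_scaleR)
  also have "\<dots> = (\<Sum>(i,k)\<in>UNIV \<times> UNIV. b (x $ i *\<^sub>R axis i 1) (y $ k *\<^sub>R axis k 1))"
    using assms by (rule bilinear_sum)
  also have "\<dots> = contract2 (\<lambda>i j. gram b $ i $ j) x y"
    unfolding contract2_def gram_def
    by (simp add: sum.cartesian_product bilinear_lmul[OF assms] bilinear_rmul[OF assms] mult_ac)
  finally show ?thesis by simp
qed

lemma invertible_gram:
  assumes b: "bilinear b" and bp: "\<And>x. x \<noteq> 0 \<Longrightarrow> 0 < b x x"
  shows "invertible (gram b)"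
proof -
  have "x = 0" if "gram b *v x = 0" for x
  proof (rule ccontr)
    assume "x \<noteq> 0"
    have "b x x = (\<Sum>i\<in>UNIV. x $ i * (gram b *v x) $ i)"
      using contract2_gram[OF b, of x x] unfolding contract2_def matrix_vector_mult_def
      by (simp add: sum_distrib_left mult_ac)
    then show False using bp[OF \<open>x \<noteq> 0\<close>] that by simp
  qed
  then show ?thesis unfolding invertible_left_inverse matrix_left_invertible_ker by blast
qed

text \<open>Lowering both indices of one argument turns the induced inner product into half the
  entrywise pairing; the half compensates for counting each index pair twice.\<close>

lemma bivector_inner_lowered:
  assumes "\<And>x y. b x y = b y x"
  shows "bivector_inner b \<omega> \<eta> = (\<Sum>k\<in>UNIV. \<Sum>l\<in>UNIV. (gram b ** \<omega> ** gram b) $ k $ l * \<eta> $ k $ l) / 2"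
proof -
  define B where "B i k = b (axis i 1) (axis k 1)" for i k
  have "bivector_inner b \<omega> \<eta> * 2 = (\<Sum>i\<in>UNIV. \<Sum>j\<in>UNIV. \<Sum>k\<in>UNIV. \<Sum>l\<in>UNIV.
      \<omega> $ i $ j * \<eta> $ k $ l * B i k * B j l)"
    unfolding bivector_inner_def B_def by simp
  also have "\<dots> = (\<Sum>j\<in>UNIV. \<Sum>i\<in>UNIV. \<Sum>k\<in>UNIV. \<Sum>l\<in>UNIV. \<omega> $ i $ j * \<eta> $ k $ l * B i k * B j l)"
    by (rule sum.swap)
  also have "\<dots> = (\<Sum>j\<in>UNIV. \<Sum>k\<in>UNIV. \<Sum>i\<in>UNIV. \<Sum>l\<in>UNIV. \<omega> $ i $ j * \<eta> $ k $ l * B i k * B j l)"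
    by (rule sum.cong[OF refl], rule sum.swap)
  also have "\<dots> = (\<Sum>k\<in>UNIV. \<Sum>j\<in>UNIV. \<Sum>l\<in>UNIV. \<Sum>i\<in>UNIV. \<omega> $ i $ j * \<eta> $ k $ l * B i k * B j l)"
    by (subst sum.swap, rule sum.cong[OF refl], rule sum.cong[OF refl], rule sum.swap)
  also have "\<dots> = (\<Sum>k\<in>UNIV. \<Sum>l\<in>UNIV. \<Sum>j\<in>UNIV. \<Sum>i\<in>UNIV. \<omega> $ i $ j * \<eta> $ k $ l * B i k * B j l)"
    by (rule sum.cong[OF refl], rule sum.swap)
  also have "\<dots> = (\<Sum>k\<in>UNIV. \<Sum>l\<in>UNIV. (gram b ** \<omega> ** gram b) $ k $ l * \<eta> $ k $ l)"
    unfolding matrix_matrix_mult_def gram_def B_def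
    by (simp add: sum_distrib_left sum_distrib_right mult_ac assms[of "axis _ 1" "axis k 1" for k])
  finally show ?thesis by simp
qed

text \<open>Nondegeneracy on bivectors. Testing on wedges of basis vectors reads off the
  antisymmetric lowered matrix entry by entry, and raising the indices recovers
  \<open>\<omega>\<close>.\<close>

lemma bivector_eq_zeroI:
  fixes b :: "real ^ 'n::finite \<Rightarrow> real ^ 'n \<Rightarrow> real"
  assumes b: "bilinear b" and bs: "\<And>x y. b x y = b y x" and bp: "\<And>x. x \<noteq> 0 \<Longrightarrow> 0 < b x x"
    and \<omega>: "\<omega> \<in> bivectors" and z: "\<And>z t. bivector_inner b \<omega> (wedge z t) = 0"
  shows "\<omega> = 0"
proof -
  define L where "L = gram b ** \<omega> ** gram b"
  have Gt: "transpose (gram b) = gram b" unfolding transpose_def gram_def vec_eq_iff using bs by simp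
  have "transpose \<omega> = - \<omega>" using \<omega> unfolding mem_bivectors_iff .
  then have "transpose L = - L"
    using transpose_sandwich[of \<omega> "gram b"] unfolding L_def Gt by blast
  then have anti: "L $ l $ k = - L $ k $ l" for k l
    unfolding mem_bivectors_iff[symmetric] bivectors_def by blast
  have "L $ p $ q = 0" for p q
  proof -
    have "(\<Sum>k\<in>UNIV. \<Sum>l\<in>UNIV. L $ k $ l * wedge (axis p 1) (axis q 1) $ k $ l) = L $ p $ q - L $ q $ p"
      by (simp add: wedge_def axis_def algebra_simps sum_subtractf if_distrib[of "\<lambda>x. _ * x"] sum.delta
          cong: if_cong)
    then show ?thesis
      using z[of "axis p 1" "axis q 1"] anti[of q p] unfolding bivector_inner_lowered[OF bs] L_def by simp
  qed
  then have L0: "L = 0" by (simp add: vec_eq_iff)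
  note inv = matrix_inv_inverse[OF invertible_gram[OF b bp]]
  have "matrix_inv (gram b) ** L ** matrix_inv (gram b) = (matrix_inv (gram b) ** gram b) ** \<omega> ** (gram b ** matrix_inv (gram b))"
    unfolding L_def by (simp only: matrix_mul_assoc)
  then show ?thesis using inv L0 by simp
qed

text \<open>The choice in \<open>weyl_operator\<close> has the intended properties once one witness
  exists; the witness is the Weyl tensor with its second pair of indices raised.\<close>

lemma weyl_operator_spec:
  fixes A :: "('a, 'n::finite) chart set" and g :: "('a, 'n) metric_field" and p :: 'a
  defines "W \<equiv> weyl (metric_coord A g (chart_at A p)) (cmap (chart_at A p) p)"
  assumes b: "bilinear (g p)" and bs: "\<And>x y. g p x y = g p y x" and bp: "\<And>x. x \<noteq> 0 \<Longrightarrow> 0 < g p x x"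
    and a1: "\<And>i j k l. W i j k l = - W j i k l" and a2: "\<And>i j k l. W i j k l = - W i j l k"
  shows "linear (weyl_operator A g p)" "weyl_operator A g p ` bivectors \<subseteq> bivectors"
    "bivector_inner (g p) (weyl_operator A g p (wedge x y)) (wedge z t) = contract4 W x y z t"
proof -
  have wt: "weyl_tensor A g p = contract4 W" unfolding weyl_tensor_def contract4_def W_def by (intro ext) simp
  define H where "H = matrix_inv (gram (g p))"
  define N :: "real ^ 'n ^ 'n \<Rightarrow> real ^ 'n ^ 'n"
    where "N \<omega> = (\<chi> k l. \<Sum>i\<in>UNIV. \<Sum>j\<in>UNIV. W i j k l * \<omega> $ i $ j)" for \<omega>
  \<comment> \<open>\<open>N (wedge x y)\<close> already counts each index pair twice, and pairing
    it with \<open>wedge z t\<close> doubles again; the factor 1/2 here and the one in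
    \<open>bivector_inner\<close> absorb the resulting 4. With \<open>transpose H\<close> on the
    left, antisymmetry is an instance of \<open>transpose_sandwich\<close>.\<close>
  define T where "T \<omega> = (1 / 2) *\<^sub>R (transpose H ** N \<omega> ** H)" for \<omega>
  have linN: "linear N" unfolding N_def
    by (rule linearI) (simp_all add: vec_eq_iff algebra_simps sum.distrib sum_distrib_left)
  have lT: "linear T"
    using linear_compose[OF linear_compose[OF linN linear_matrix_sandwich[of "transpose H" H]] linear_scaleR[of "1 / 2"]]
    unfolding T_def comp_def .
  have Nt: "transpose (N \<omega>) = - N \<omega>" for \<omega>
  proof -
    have "N \<omega> $ l $ k = - N \<omega> $ k $ l" for k l
      unfolding N_def vec_lambda_beta sum_negf[symmetric] by (intro sum.cong refl) (subst a2, simp)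
    then show ?thesis unfolding mem_bivectors_iff[symmetric] bivectors_def by blast
  qed
  have bT: "T ` bivectors \<subseteq> bivectors"
  proof
    fix \<eta> assume "\<eta> \<in> T ` bivectors"
    then obtain \<omega> where "\<eta> = T \<omega>" by blast
    moreover have "transpose (T \<omega>) = - T \<omega>"
      unfolding T_def transpose_scalar transpose_sandwich[OF Nt] by simp
    ultimately show "\<eta> \<in> bivectors" unfolding mem_bivectors_iff by simp
  qed
  have "bivector_inner (g p) (T (wedge x y)) (wedge z t) = contract4 W x y z t" for x y z t
  proof -
    note inv = matrix_inv_inverse[OF invertible_gram[OF b bp], folded H_def]
    have Gt: "transpose (gram (g p)) = gram (g p)" unfolding transpose_def gram_def vec_eq_iff using bs by simp
    have GHt: "gram (g p) ** transpose H = mat 1"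
      using arg_cong[OF inv(2), of transpose] unfolding matrix_transpose_mul Gt by (simp add: transpose_mat)
    have "gram (g p) ** T \<omega> ** gram (g p) =
        (1 / 2) *\<^sub>R ((gram (g p) ** transpose H) ** N \<omega> ** (H ** gram (g p)))" for \<omega>
      unfolding T_def linear_scale[OF linear_matrix_sandwich] by (simp only: matrix_mul_assoc)
    then have low: "gram (g p) ** T \<omega> ** gram (g p) = (1 / 2) *\<^sub>R N \<omega>" for \<omega>
      by (simp add: inv GHt)
    have Nw: "N (wedge x y) $ k $ l = 2 * (\<Sum>i\<in>UNIV. \<Sum>j\<in>UNIV. W i j k l * x $ i * y $ j)" for k l
    proof -
      have "N (wedge x y) $ k $ l = (\<Sum>i\<in>UNIV. \<Sum>j\<in>UNIV. W i j k l * x $ i * y $ j)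
          - (\<Sum>i\<in>UNIV. \<Sum>j\<in>UNIV. W i j k l * x $ j * y $ i)"
        unfolding N_def wedge_def by (simp add: algebra_simps sum_subtractf)
      also have "(\<Sum>i\<in>UNIV. \<Sum>j\<in>UNIV. W i j k l * x $ j * y $ i) = - (\<Sum>i\<in>UNIV. \<Sum>j\<in>UNIV. W i j k l * x $ i * y $ j)"
        by (subst sum.swap, subst a1) (simp add: sum_negf)
      finally show ?thesis by simp
    qed
    have "bivector_inner (g p) (T (wedge x y)) (wedge z t) =
        (\<Sum>k\<in>UNIV. \<Sum>l\<in>UNIV. N (wedge x y) $ k $ l * wedge z t $ k $ l) / 4"
      unfolding bivector_inner_lowered[OF bs] low by (simp add: sum_divide_distrib)
    also have "(\<Sum>k\<in>UNIV. \<Sum>l\<in>UNIV. N (wedge x y) $ k $ l * wedge z t $ k $ l) =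
        (\<Sum>k\<in>UNIV. \<Sum>l\<in>UNIV. N (wedge x y) $ k $ l * z $ k * t $ l)
        - (\<Sum>k\<in>UNIV. \<Sum>l\<in>UNIV. N (wedge x y) $ k $ l * z $ l * t $ k)"
      unfolding wedge_def[of z] by (simp add: algebra_simps sum_subtractf)
    also have "(\<Sum>k\<in>UNIV. \<Sum>l\<in>UNIV. N (wedge x y) $ k $ l * z $ l * t $ k)
        = - (\<Sum>k\<in>UNIV. \<Sum>l\<in>UNIV. N (wedge x y) $ k $ l * z $ k * t $ l)"
    proof -
      have "N \<omega> $ l $ k = - N \<omega> $ k $ l" for \<omega> k l
        using Nt[of \<omega>] unfolding mem_bivectors_iff[symmetric] bivectors_def by blast
      then have "N (wedge x y) $ k $ l * z $ l * t $ k = - (N (wedge x y) $ l $ k * z $ l * t $ k)" for k l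
        by (metis minus_mult_left)
      then show ?thesis by (subst sum.swap) (simp only: sum_negf)
    qed
    also have "(\<Sum>k\<in>UNIV. \<Sum>l\<in>UNIV. N (wedge x y) $ k $ l * z $ k * t $ l) = 2 * contract4 W x y z t"
    proof -
      have "contract4 W x y z t = contract4 (\<lambda>i j k l. W k l i j) z t x y" by (rule contract4_swap_pairs[symmetric])
      then show ?thesis unfolding contract4_def Nw by (simp add: sum_distrib_left sum_distrib_right mult_ac)
    qed
    finally show ?thesis by simp
  qed
  then have spec: "linear T \<and> T ` bivectors \<subseteq> bivectors \<and>
      (\<forall>x y z t. bivector_inner (g p) (T (wedge x y)) (wedge z t) = weyl_tensor A g p x y z t)"
    using lT bT unfolding wt by blast
  have "linear (weyl_operator A g p) \<and> weyl_operator A g p ` bivectors \<subseteq> bivectors \<and>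
      (\<forall>x y z t. bivector_inner (g p) (weyl_operator A g p (wedge x y)) (wedge z t) = weyl_tensor A g p x y z t)"
    unfolding weyl_operator_def
    by (rule someI[where P = "\<lambda>T. linear T \<and> T ` bivectors \<subseteq> bivectors \<and>
      (\<forall>x y z t. bivector_inner (g p) (T (wedge x y)) (wedge z t) = weyl_tensor A g p x y z t)", OF spec])
  then show "linear (weyl_operator A g p)" "weyl_operator A g p ` bivectors \<subseteq> bivectors"
    "bivector_inner (g p) (weyl_operator A g p (wedge x y)) (wedge z t) = contract4 W x y z t"
    unfolding wt by simp_all
qed

text \<open>On bivectors, v \<and> v-perp is the orthogonal complement of the wedges of vectors from
  v-perp. The factor \<open>u\<close> is found by representing the functional that sends
  \<open>t\<close> to the product of \<open>\<omega>\<close> with \<open>wedge v t\<close>.\<close>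

lemma mem_wedge_perpI:
  fixes b :: "real ^ 'n::finite \<Rightarrow> real ^ 'n \<Rightarrow> real"
  assumes b: "bilinear b" and bs: "\<And>x y. b x y = b y x" and bp: "\<And>x. x \<noteq> 0 \<Longrightarrow> 0 < b x x"
    and v: "v \<noteq> 0" and \<omega>: "\<omega> \<in> bivectors"
    and perp: "\<And>z t. b v z = 0 \<Longrightarrow> b v t = 0 \<Longrightarrow> bivector_inner b \<omega> (wedge z t) = 0"
  shows "\<omega> \<in> wedge_perp b v"
proof -
  note bi = bilinear_ladd[OF b] bilinear_radd[OF b] bilinear_lmul[OF b] bilinear_rmul[OF b]
  note lw = linear_wedge linear_bivector_inner
  define N where "N = b v v"
  have N: "N > 0" unfolding N_def using bp v .
  \<comment> \<open>For \<open>u\<close> orthogonal to \<open>v\<close>, the product of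
    \<open>wedge v u\<close> with \<open>wedge v t\<close> is \<open>N * b u t\<close>; hence the
    division by \<open>N\<close>.\<close>
  have "linear (\<lambda>t. bivector_inner b \<omega> (wedge v t) / N)"
    by (rule linearI) (simp_all add: linear_add[OF linear_wedge] linear_scale[OF linear_wedge]
        linear_add[OF linear_bivector_inner] linear_scale[OF linear_bivector_inner] add_divide_distrib)
  from bilinear_representation[OF b bp this]
  obtain u where "\<forall>t. bivector_inner b \<omega> (wedge v t) / N = b u t" by blast
  then have u: "bivector_inner b \<omega> (wedge v t) = N * b u t" for t using N by (simp add: field_simps)
  have "wedge v v = 0" unfolding wedge_def vec_eq_iff by (simp add: mult.commute)
  then have "N * b u v = 0" using u[of v] linear_0[OF linear_bivector_inner[of b \<omega>]] by simp
  then have uv: "b u v = 0" using N by simp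
  define \<delta> where "\<delta> = \<omega> - wedge v u"
  have \<delta>v: "bivector_inner b \<delta> (wedge v t) = 0" for t
    unfolding \<delta>_def bivector_inner_diff u bivector_inner_wedge[OF b] by (simp add: bs[of v u] uv N_def)
  have \<delta>perp: "bivector_inner b \<delta> (wedge z t) = 0" if "b v z = 0" "b v t = 0" for z t
    unfolding \<delta>_def bivector_inner_diff bivector_inner_wedge[OF b] using perp that by simp
  have "\<delta> = 0"
  proof (rule bivector_eq_zeroI[OF b bs bp])
    show "\<delta> \<in> bivectors" 
      unfolding \<delta>_def by (rule subspace_diff[OF subspace_bivectors \<omega> wedge_in_bivectors])
    fix z t
    define \<alpha> \<beta> where "\<alpha> = b v z / N" and "\<beta> = b v t / N"
    define z' t' where "z' = z - \<alpha> *\<^sub>R v" and "t' = t - \<beta> *\<^sub>R v"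
    have p: "b v z' = 0" "b v t' = 0" using N unfolding z'_def t'_def \<alpha>_def \<beta>_def
      by (simp_all add: bilinear_rsub[OF b] bi N_def)
    \<comment> \<open>Split \<open>z\<close> and \<open>t\<close> into components along
      \<open>v\<close> and orthogonal to it. The first wedge may contain \<open>t\<close> in place
      of \<open>t'\<close>, since the difference is a multiple of
      \<open>wedge v v = 0\<close>.\<close>
    have "wedge z t = wedge v (\<alpha> *\<^sub>R t - \<beta> *\<^sub>R z') + wedge z' t'"
      unfolding z'_def t'_def by (simp add: wedge_def vec_eq_iff algebra_simps)
    then show "bivector_inner b \<delta> (wedge z t) = 0"
      by (simp only: linear_add[OF linear_bivector_inner] \<delta>v \<delta>perp[OF p])
  qed
  then have "\<omega> = wedge v u" unfolding \<delta>_def by simp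
  moreover have "b v u = 0" using uv bs by metis
  ultimately show ?thesis unfolding wedge_perp_def by blast
qed

text \<open>The hypothesis \<open>W0\<close> says that images of v \<and> v-perp are orthogonal to
  wedges of vectors from v-perp, which is the membership criterion. The restricted operator is then,
  up to the factor b(v, v), the form W(v, ., v, .), so eigenvectors of that form give simple
  eigenbivectors.\<close>

lemma weyl_operator_preserves_wedge_perp:
  fixes T :: "real ^ 'n::finite ^ 'n \<Rightarrow> real ^ 'n ^ 'n"
  assumes b: "bilinear b" and bs: "\<And>x y. b x y = b y x" and bp: "\<And>x. x \<noteq> 0 \<Longrightarrow> 0 < b x x"
    and v: "v \<noteq> 0" and T: "linear T" "T ` bivectors \<subseteq> bivectors"
    and spec: "\<And>x y z t. bivector_inner b (T (wedge x y)) (wedge z t) = contract4 W x y z t"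
    and sym: "\<And>i j k l. W i j k l = W k l i j"
    and W0: "\<And>w z t. b v w = 0 \<Longrightarrow> b v z = 0 \<Longrightarrow> b v t = 0 \<Longrightarrow> contract4 W v w z t = 0"
  shows "T ` wedge_perp b v \<subseteq> wedge_perp b v"
    "\<exists>E. card E = CARD('n) - 1 \<and> independent E \<and>
      (\<forall>\<omega>\<in>E. simple_bivector \<omega> \<and> \<omega> \<noteq> 0 \<and> (\<exists>\<mu>. T \<omega> = \<mu> *\<^sub>R \<omega>))"
proof -
  show inv: "T ` wedge_perp b v \<subseteq> wedge_perp b v"
  proof
    fix \<eta> assume "\<eta> \<in> T ` wedge_perp b v"
    then obtain w where w: "\<eta> = T (wedge v w)" "b v w = 0" unfolding wedge_perp_def by blast
    show "\<eta> \<in> wedge_perp b v"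
    proof (rule mem_wedge_perpI[OF b bs bp v])
      show "\<eta> \<in> bivectors" using w T(2) wedge_in_bivectors by blast
      show "bivector_inner b \<eta> (wedge z t) = 0" if "b v z = 0" "b v t = 0" for z t
        unfolding w(1) spec using W0 w(2) that by blast
    qed
  qed
  define N where "N = b v v"
  have N: "N > 0" unfolding N_def using bp v .
  define V where "V = {w. b v w = 0}"
  have lb: "linear (b v)" using b unfolding bilinear_def by blast
  have sV: "subspace V" unfolding V_def using linear_subspace_kernel[OF lb] by simp
  have dV: "dim V = CARD('n) - 1"
  proof -
    \<comment> \<open>The Euclidean normal of \<open>V\<close>: it exhibits the
      \<open>b\<close>-orthogonal complement of \<open>v\<close> as an ordinary hyperplane.\<close>
    define c where "c = (\<chi> i. b v (axis i 1))"
    have c: "b v w = c \<bullet> w" for w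
    proof -
      have "b v w = b v (\<Sum>i\<in>UNIV. w $ i *\<^sub>R axis i 1)"
        by (metis (no_types) basis_expansion scalar_mult_eq_scaleR)
      then show ?thesis
        by (simp add: linear_sum[OF lb] linear_scale[OF lb] c_def inner_vec_def mult.commute)
    qed
    have "c \<noteq> 0" using N c unfolding N_def by fastforce
    then show ?thesis unfolding V_def c by (simp add: dim_hyperplane)
  qed
  obtain B where B: "B \<subseteq> V" "independent B" "card B = dim V"
    and ev: "\<And>w. w \<in> B \<Longrightarrow> \<exists>\<mu>. \<forall>t\<in>V. contract4 W v w v t = \<mu> * b w t"
  proof -
    have "W = (\<lambda>i j k l. W k l i j)" by (intro ext) (rule sym)
    then have "contract4 W v x v y = contract4 W v y v x" for x y
      using contract4_swap_pairs[of W v x v y] by metis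
    from simultaneous_diagonalization[OF b bs bp bilinear_contract4_sandwich this sV]
    show thesis using that by blast
  qed
  \<comment> \<open>Wedging with \<open>v\<close> is injective on \<open>V\<close>, so it carries
    the independence and cardinality of \<open>B\<close> over to bivectors.\<close>
  have ker: "w = 0" if "w \<in> V" "wedge v w = 0" for w
  proof (rule ccontr)
    assume "w \<noteq> 0"
    have "bivector_inner b (wedge v w) (wedge v w) = N * b w w"
      unfolding bivector_inner_wedge[OF b] using that(1) unfolding V_def N_def by simp
    moreover have "bivector_inner b (wedge v w) (wedge v w) = 0"
      unfolding that(2) using linear_0[OF linear_bivector_inner] .
    ultimately show False using N bp[OF \<open>w \<noteq> 0\<close>] by simp
  qed
  have inj: "inj_on (wedge v) V"
  proof (rule inj_onI)
    fix x y assume "x \<in> V" "y \<in> V" "wedge v x = wedge v y"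
    then have "x - y = 0"
      using ker[of "x - y"] sV by (simp add: subspace_diff linear_diff[OF linear_wedge])
    then show "x = y" by simp
  qed
  have spB: "span B \<subseteq> V" using B(1) sV by (rule span_minimal)
  show "\<exists>E. card E = CARD('n) - 1 \<and> independent E \<and>
      (\<forall>\<omega>\<in>E. simple_bivector \<omega> \<and> \<omega> \<noteq> 0 \<and> (\<exists>\<mu>. T \<omega> = \<mu> *\<^sub>R \<omega>))"
  proof (intro exI[of _ "wedge v ` B"] conjI ballI)
    show "card (wedge v ` B) = CARD('n) - 1"
      using card_image[OF inj_on_subset[OF inj B(1)]] B(3) dV by simp
    show ind: "independent (wedge v ` B)"
      by (rule linear_independent_injective_image[OF linear_wedge B(2) inj_on_subset[OF inj spB]])
    fix \<omega> assume \<omega>: "\<omega> \<in> wedge v ` B"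
    then show "simple_bivector \<omega>" unfolding simple_bivector_def by blast
    show "\<omega> \<noteq> 0" using ind \<omega> dependent_zero by blast
    obtain w where w: "w \<in> B" "\<omega> = wedge v w" using \<omega> by blast
    then have wV: "w \<in> V" using B by blast
    have "T \<omega> \<in> wedge_perp b v" using inv wV w unfolding wedge_perp_def V_def by blast
    then obtain u where u: "T \<omega> = wedge v u" "b v u = 0" unfolding wedge_perp_def by blast
    obtain \<mu> where \<mu>: "\<forall>t\<in>V. contract4 W v w v t = \<mu> * b w t" using ev[OF w(1)] by blast
    have bu: "N * b u t = \<mu> * b w t" if "t \<in> V" for t
    proof -
      have "contract4 W v w v t = bivector_inner b (wedge v u) (wedge v t)" using spec[of v w v t] u w by simp
      also have "\<dots> = N * b u t" unfolding bivector_inner_wedge[OF b] using that unfolding V_def N_def by simp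
      finally show ?thesis using \<mu> that by simp
    qed
    \<comment> \<open>The eigenvalue is \<mu> / N because wedging with \<open>v\<close> multiplies
      the inner product on \<open>V\<close> by \<open>N\<close>; the difference \<open>d\<close>
      lies in \<open>V\<close> and is orthogonal to itself.\<close>
    define d where "d = u - (\<mu> / N) *\<^sub>R w"
    have "u \<in> V" using u unfolding V_def by simp
    then have "d \<in> V" unfolding d_def by (intro subspace_diff subspace_scale sV wV)
    then have "N * b d d = 0"
      using bu[of d] N by (subst d_def) (simp add: bilinear_lsub[OF b] bilinear_lmul[OF b] algebra_simps)
    then have "d = 0" using bp[of d] N by (metis less_irrefl mult_eq_0_iff)
    then have "u = (\<mu> / N) *\<^sub>R w" unfolding d_def by simp
    then show "\<exists>\<mu>. T \<omega> = \<mu> *\<^sub>R \<omega>" using u w linear_scale[OF linear_wedge] by metis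
  qed
qed

section \<open>Curvature of a metric in coordinates\<close>

lemma matrix_inv_symmetric:
  fixes B :: "real ^ 'n::finite ^ 'n"
  assumes "invertible B" "\<And>i j. B $ i $ j = B $ j $ i"
  shows "matrix_inv B $ i $ j = matrix_inv B $ j $ i"
proof -
  note inv = matrix_inv_inverse[OF assms(1)]
  have Bt: "transpose B = B" unfolding transpose_def vec_eq_iff using assms(2) by simp
  have "transpose (matrix_inv B) ** B = mat 1"
    using arg_cong[OF inv(1), of transpose] unfolding matrix_transpose_mul Bt by simp
  then have "transpose (matrix_inv B) = transpose (matrix_inv B) ** (B ** matrix_inv B)"
    unfolding inv(1) by simp
  also have "\<dots> = matrix_inv B"
    unfolding matrix_mul_assoc \<open>transpose (matrix_inv B) ** B = mat 1\<close> by simp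
  finally have "transpose (matrix_inv B) $ j $ i = matrix_inv B $ j $ i" by simp
  then show ?thesis unfolding transpose_def by simp
qed

text \<open>The classical octahedron argument: the four Bianchi identities for the cyclic shifts of
  (i, j, k, l), combined linearly after the antisymmetries identify equal terms.\<close>

lemma curvature_pair_symmetry:
  fixes R :: "'n \<Rightarrow> 'n \<Rightarrow> 'n \<Rightarrow> 'n \<Rightarrow> real"
  assumes a1: "\<And>i j k l. R i j k l = - R j i k l" and a2: "\<And>i j k l. R i j k l = - R i j l k"
    and bianchi: "\<And>i j k l. R i j k l + R i k l j + R i l j k = 0"
  shows "R i j k l = R k l i j"
  using bianchi[of i j k l] bianchi[of j k l i] bianchi[of k l i j] bianchi[of l i j k]
    a1[of j k l i] a2[of k j l i] a1[of j l i k] a2[of l j i k] a1[of j i k l]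
    a1[of k l i j] a1[of k i j l] a2[of i k j l] a1[of k j l i]
    a1[of l i j k] a2[of i l j k] a1[of l j k i] a1[of l k i j] a2[of j l k i] a2[of j l i k] a2[of j k l i]
    a2[of j i k l] a2[of k l i j] a2[of l k i j] a2[of i k l j] a2[of l i j k]
  by linarith

text \<open>The coordinate form of a nondegenerate metric with two derivatives. These conditions are
  stable under a twice differentiable conformal change, so several metrics of one class can share
  the same \<open>U\<close>.\<close>

locale coordinate_metric =
  fixes G :: "real ^ 'n::finite \<Rightarrow> real ^ 'n ^ 'n" and U :: "(real ^ 'n) set"
  assumes open_U: "open U"
    and sym: "\<And>y i j. y \<in> U \<Longrightarrow> G y $ i $ j = G y $ j $ i"
    and inv: "\<And>y. y \<in> U \<Longrightarrow> invertible (G y)"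
    and diff: "\<And>y i j. y \<in> U \<Longrightarrow> (\<lambda>y. G y $ i $ j) differentiable at y"
    and diff2: "\<And>y i j k. y \<in> U \<Longrightarrow> pderiv_at k (\<lambda>y. G y $ i $ j) differentiable at y"
begin

lemma christoffel_sym: "x \<in> U \<Longrightarrow> christoffel G x k i j = christoffel G x k j i"
  and metric_compat: "x \<in> U \<Longrightarrow> pderiv_at k (\<lambda>y. G y $ i $ j) x =
    (\<Sum>l\<in>UNIV. christoffel G x l k i * G x $ l $ j) + (\<Sum>l\<in>UNIV. christoffel G x l k j * G x $ i $ l)"
  using christoffel_unique[OF open_U _ sym inv diff, THEN iffD2, OF _ _ _ _ refl] by blast+

lemma differentiable_inv: "x \<in> U \<Longrightarrow> (\<lambda>y. matrix_inv (G y) $ k $ l) differentiable at x"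
  using differentiable_matrix_inv[OF open_U _ diff inv] by blast

lemma differentiable_christoffel: "x \<in> U \<Longrightarrow> (\<lambda>y. christoffel G y k i j) differentiable at x"
  unfolding christoffel_def
  by (intro differentiable_sum differentiable_mult differentiable_divide differentiable_add
      differentiable_diff differentiable_const ballI differentiable_inv diff2) auto

lemma inv_left: "x \<in> U \<Longrightarrow> (\<Sum>k\<in>UNIV. matrix_inv (G x) $ p $ k * G x $ k $ q) = (if p = q then 1 else 0)"
  using arg_cong[OF matrix_inv_inverse(2)[OF inv], of x "\<lambda>B. B $ p $ q"]
  by (simp add: matrix_matrix_mult_def mat_def)

section \<open>Algebraic symmetries of the Riemann, Ricci, Schouten and Weyl tensors\<close>

lemma riem_up_antisym: "riem_up G x i j k l = - riem_up G x i j l k"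
  unfolding riem_up_def by (simp add: sum_subtractf)

lemma riem_antisym_last: "riem G x i j k l = - riem G x i j l k"
  unfolding riem_def by (simp add: sum_negf[symmetric] riem_up_antisym[of x _ j k l])

lemma riem_up_bianchi:
  assumes x: "x \<in> U"
  shows "riem_up G x i j k l + riem_up G x i k l j + riem_up G x i l j k = 0"
proof -
  have p: "pderiv_at c (\<lambda>y. christoffel G y i a b) x = pderiv_at c (\<lambda>y. christoffel G y i b a) x" for a b c
    by (rule pderiv_at_cong[OF open_U x]) (rule christoffel_sym)
  show ?thesis
    unfolding riem_up_def
    by (simp add: sum_subtractf p[of _ k j] p[of _ l k] p[of _ j l]
        christoffel_sym[OF x, of _ k j] christoffel_sym[OF x, of _ l k] christoffel_sym[OF x, of _ j l])
qed

lemma riem_bianchi: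
  assumes x: "x \<in> U"
  shows "riem G x i j k l + riem G x i k l j + riem G x i l j k = 0"
proof -
  have "riem G x i j k l + riem G x i k l j + riem G x i l j k =
      (\<Sum>m\<in>UNIV. G x $ i $ m * (riem_up G x m j k l + riem_up G x m k l j + riem_up G x m l j k))"
    unfolding riem_def by (simp add: sum.distrib distrib_left)
  then show ?thesis by (simp add: riem_up_bianchi[OF x])
qed

text \<open>Christoffel symbols of the first kind.\<close>

definition low :: "'n \<Rightarrow> 'n \<Rightarrow> 'n \<Rightarrow> real ^ 'n \<Rightarrow> real"
  where "low i k j y = (\<Sum>m\<in>UNIV. G y $ i $ m * christoffel G y m k j)"

lemma differentiable_low: "x \<in> U \<Longrightarrow> low i k j differentiable at x"
  unfolding low_def[abs_def]
  by (intro differentiable_sum differentiable_mult ballI diff differentiable_christoffel) auto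

lemma metric_compat_low:
  assumes x: "x \<in> U"
  shows "pderiv_at k (\<lambda>y. G y $ i $ j) x = low j k i x + low i k j x"
proof -
  have "(\<Sum>l\<in>UNIV. christoffel G x l k i * G x $ l $ j) = low j k i x"
    unfolding low_def by (rule sum.cong[OF refl], subst sym[OF x], rule mult.commute)
  moreover have "(\<Sum>l\<in>UNIV. christoffel G x l k j * G x $ i $ l) = low i k j x"
    unfolding low_def by (simp add: mult.commute)
  ultimately show ?thesis using metric_compat[OF x] by simp
qed

text \<open>Moving G inside the derivatives of the Christoffel symbols costs derivatives of G. By
  metric compatibility one half of that cost cancels the quadratic terms of the curvature, and the
  other half is what remains here.\<close>

lemma riem_low:
  assumes x: "x \<in> U"
  shows "riem G x i j k l = pderiv_at k (low i l j) x - pderiv_at l (low i k j) x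
    - (\<Sum>m\<in>UNIV. low m k i x * christoffel G x m l j) + (\<Sum>m\<in>UNIV. low m l i x * christoffel G x m k j)"
proof -
  have pl: "pderiv_at k (low i l j) x = (\<Sum>m\<in>UNIV. low m k i x * christoffel G x m l j)
      + (\<Sum>m\<in>UNIV. low i k m x * christoffel G x m l j)
      + (\<Sum>m\<in>UNIV. G x $ i $ m * pderiv_at k (\<lambda>y. christoffel G y m l j) x)" for k l
  proof -
    have "pderiv_at k (low i l j) x = (\<Sum>m\<in>UNIV. pderiv_at k (\<lambda>y. G y $ i $ m * christoffel G y m l j) x)"
      unfolding low_def[abs_def]
      by (rule pderiv_at_sum) (intro differentiable_mult diff differentiable_christoffel x)
    also have "\<dots> = (\<Sum>m\<in>UNIV. (low m k i x + low i k m x) * christoffel G x m l j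
        + G x $ i $ m * pderiv_at k (\<lambda>y. christoffel G y m l j) x)"
      by (rule sum.cong[OF refl])
        (simp add: pderiv_at_mult diff differentiable_christoffel x metric_compat_low)
    finally show ?thesis by (simp add: sum.distrib distrib_right)
  qed
  have qq: "(\<Sum>m\<in>UNIV. G x $ i $ m * (\<Sum>p\<in>UNIV. christoffel G x m k p * christoffel G x p l j)) =
      (\<Sum>p\<in>UNIV. low i k p x * christoffel G x p l j)" for k l
  proof -
    have "(\<Sum>m\<in>UNIV. G x $ i $ m * (\<Sum>p\<in>UNIV. christoffel G x m k p * christoffel G x p l j)) =
        (\<Sum>m\<in>UNIV. \<Sum>p\<in>UNIV. G x $ i $ m * christoffel G x m k p * christoffel G x p l j)"
      by (simp add: sum_distrib_left mult.assoc)
    also have "\<dots> = (\<Sum>p\<in>UNIV. \<Sum>m\<in>UNIV. G x $ i $ m * christoffel G x m k p * christoffel G x p l j)"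
      by (rule sum.swap)
    finally show ?thesis unfolding low_def by (simp add: sum_distrib_right)
  qed
  have "riem G x i j k l =
      (\<Sum>m\<in>UNIV. G x $ i $ m * pderiv_at k (\<lambda>y. christoffel G y m l j) x)
      - (\<Sum>m\<in>UNIV. G x $ i $ m * pderiv_at l (\<lambda>y. christoffel G y m k j) x)
      + (\<Sum>m\<in>UNIV. G x $ i $ m * (\<Sum>p\<in>UNIV. christoffel G x m k p * christoffel G x p l j))
      - (\<Sum>m\<in>UNIV. G x $ i $ m * (\<Sum>p\<in>UNIV. christoffel G x m l p * christoffel G x p k j))"
    unfolding riem_def riem_up_def
    by (simp add: sum_subtractf distrib_left right_diff_distrib sum.distrib)
  then show ?thesis using pl[of k l] pl[of l k] unfolding qq by simp
qed

text \<open>In the sum over both orders of \<open>i\<close> and \<open>j\<close> the derivative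
  terms become a commutator of second partial derivatives of the metric, and the quadratic terms
  cancel by symmetry of the metric.\<close>

lemma riem_antisym_first:
  assumes x: "x \<in> U"
  shows "riem G x i j k l = - riem G x j i k l"
proof -
  have q: "(\<Sum>m\<in>UNIV. low m k i x * christoffel G x m l j) = (\<Sum>m\<in>UNIV. low m l j x * christoffel G x m k i)"
    for i j k l
  proof -
    have "(\<Sum>m\<in>UNIV. low m k i x * christoffel G x m l j) =
        (\<Sum>m\<in>UNIV. \<Sum>p\<in>UNIV. G x $ m $ p * christoffel G x p k i * christoffel G x m l j)"
      unfolding low_def by (simp add: sum_distrib_right)
    also have "\<dots> = (\<Sum>p\<in>UNIV. \<Sum>m\<in>UNIV. G x $ m $ p * christoffel G x p k i * christoffel G x m l j)"
      by (rule sum.swap)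
    also have "\<dots> = (\<Sum>p\<in>UNIV. \<Sum>m\<in>UNIV. G x $ p $ m * christoffel G x m l j * christoffel G x p k i)"
      by (rule sum.cong[OF refl], rule sum.cong[OF refl], subst sym[OF x], simp)
    finally show ?thesis unfolding low_def by (simp add: sum_distrib_right)
  qed
  have pd: "pderiv_at k (low i l j) x + pderiv_at k (low j l i) x = pderiv_at k (pderiv_at l (\<lambda>y. G y $ i $ j)) x"
    for k l
  proof -
    have "pderiv_at k (pderiv_at l (\<lambda>y. G y $ i $ j)) x = pderiv_at k (\<lambda>y. low j l i y + low i l j y) x"
      by (rule pderiv_at_cong[OF open_U x]) (rule metric_compat_low)
    also have "\<dots> = pderiv_at k (low j l i) x + pderiv_at k (low i l j) x"
      by (intro pderiv_at_add differentiable_low x)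
    finally show ?thesis by simp
  qed
  have "pderiv_at k (pderiv_at l (\<lambda>y. G y $ i $ j)) x = pderiv_at l (pderiv_at k (\<lambda>y. G y $ i $ j)) x"
    by (rule pderiv_at_commute[OF open_U x diff]) (auto intro: diff2 x)
  then show ?thesis
    unfolding riem_low[OF x] using pd[of k l] pd[of l k] q[of k i l j] q[of l i k j] by linarith
qed

lemma riem_pair_symmetry: "x \<in> U \<Longrightarrow> riem G x i j k l = riem G x k l i j"
  by (rule curvature_pair_symmetry) (rule riem_antisym_first riem_antisym_last riem_bianchi; assumption?)+

lemma ricci_symmetric:
  assumes x: "x \<in> U"
  shows "ricci G x j l = ricci G x l j"
proof -
  have "ricci G x l j = (\<Sum>k\<in>UNIV. \<Sum>i\<in>UNIV. matrix_inv (G x) $ i $ k * riem G x i l k j)"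
    unfolding ricci_def by (rule sum.swap)
  also have "\<dots> = ricci G x j l"
    unfolding ricci_def
    by (intro sum.cong refl arg_cong2[where f = times] matrix_inv_symmetric[OF inv[OF x] sym[OF x]]
        riem_pair_symmetry[OF x])
  finally show ?thesis by simp
qed

lemma schouten_symmetric: "x \<in> U \<Longrightarrow> schouten G x i j = schouten G x j i"
  unfolding schouten_def by (simp only: ricci_symmetric[of x i j] sym[of x i j])

lemma weyl_antisym_first: "x \<in> U \<Longrightarrow> weyl G x i j k l = - weyl G x j i k l"
  unfolding weyl_def kulkarni_nomizu_def using riem_antisym_first[of x i j k l] by (simp add: algebra_simps)

lemma weyl_antisym_last: "weyl G x i j k l = - weyl G x i j l k"
  unfolding weyl_def kulkarni_nomizu_def using riem_antisym_last[of x i j k l] by (simp add: algebra_simps)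

lemma weyl_pair_symmetry:
  assumes x: "x \<in> U"
  shows "weyl G x i j k l = weyl G x k l i j"
proof -
  note s = schouten_symmetric[OF x] and g = sym[OF x]
  show ?thesis
    unfolding weyl_def kulkarni_nomizu_def
      riem_pair_symmetry[OF x, of i j k l] s[of k i] s[of l j] s[of k j] s[of l i] g[of k i] g[of l j] g[of k j] g[of l i]
    by (simp add: algebra_simps)
qed

text \<open>\<open>E l i\<close> is the covariant derivative of \<open>X\<close>. Equality of the
  mixed second partials of \<open>X\<close>, whose existence follows from \<open>eq\<close>, yields
  the identity; the terms with lower indices \<open>k\<close>, \<open>l\<close> on a Christoffel
  symbol are symmetric and so absent from the commutator.\<close>

lemma ricci_identity:
  assumes x: "x \<in> U" and X: "\<And>y i. y \<in> U \<Longrightarrow> (\<lambda>y. X y $ i) differentiable at y"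
    and E: "\<And>l i. E l i differentiable at x"
    and eq: "\<And>y l i. y \<in> U \<Longrightarrow> pderiv_at l (\<lambda>y. X y $ i) y =
      E l i y - (\<Sum>j\<in>UNIV. christoffel G y i l j * X y $ j)"
  shows "(\<Sum>j\<in>UNIV. riem_up G x i j k l * X x $ j) =
    (pderiv_at k (E l i) x + (\<Sum>j\<in>UNIV. christoffel G x i k j * E l j x))
    - (pderiv_at l (E k i) x + (\<Sum>j\<in>UNIV. christoffel G x i l j * E k j x))"
proof -
  let ?\<Gamma> = "christoffel G"
  note dG = differentiable_christoffel[OF x]
  have dS: "(\<lambda>y. \<Sum>j\<in>UNIV. ?\<Gamma> y i l j * X y $ j) differentiable at x" for i l
    by (intro differentiable_sum differentiable_mult ballI dG X x) auto
  have dX: "pderiv_at l (\<lambda>y. X y $ i) differentiable at x" for l i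
  proof (rule differentiable_cong_open[OF open_U x])
    show "(\<lambda>y. E l i y - (\<Sum>j\<in>UNIV. ?\<Gamma> y i l j * X y $ j)) differentiable at x"
      by (intro differentiable_diff E dS)
  qed (simp add: eq)
  define D where "D k l = (\<Sum>j\<in>UNIV. pderiv_at k (\<lambda>y. ?\<Gamma> y i l j) x * X x $ j)" for k l
  define Q where "Q k l = (\<Sum>j\<in>UNIV. ?\<Gamma> x i l j * E k j x)" for k l
  define C where "C k l = (\<Sum>j\<in>UNIV. ?\<Gamma> x i l j * (\<Sum>m\<in>UNIV. ?\<Gamma> x j k m * X x $ m))" for k l
  have second: "pderiv_at k (pderiv_at l (\<lambda>y. X y $ i)) x = pderiv_at k (E l i) x - D k l - Q k l + C k l" for k l
  proof -
    have "pderiv_at k (pderiv_at l (\<lambda>y. X y $ i)) x =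
        pderiv_at k (\<lambda>y. E l i y - (\<Sum>j\<in>UNIV. ?\<Gamma> y i l j * X y $ j)) x"
      by (rule pderiv_at_cong[OF open_U x]) (rule eq)
    also have "\<dots> = pderiv_at k (E l i) x - pderiv_at k (\<lambda>y. \<Sum>j\<in>UNIV. ?\<Gamma> y i l j * X y $ j) x"
      by (intro pderiv_at_diff E dS)
    also have "pderiv_at k (\<lambda>y. \<Sum>j\<in>UNIV. ?\<Gamma> y i l j * X y $ j) x =
        (\<Sum>j\<in>UNIV. pderiv_at k (\<lambda>y. ?\<Gamma> y i l j * X y $ j) x)"
      by (intro pderiv_at_sum differentiable_mult dG X x)
    also have "\<dots> = (\<Sum>j\<in>UNIV. pderiv_at k (\<lambda>y. ?\<Gamma> y i l j) x * X x $ j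
        + ?\<Gamma> x i l j * (E k j x - (\<Sum>m\<in>UNIV. ?\<Gamma> x j k m * X x $ m)))"
      by (rule sum.cong[OF refl]) (simp add: pderiv_at_mult dG X x eq)
    also have "\<dots> = D k l + Q k l - C k l"
      unfolding D_def Q_def C_def by (simp add: sum.distrib sum_subtractf right_diff_distrib)
    finally show ?thesis by simp
  qed
  have "pderiv_at k (pderiv_at l (\<lambda>y. X y $ i)) x = pderiv_at l (pderiv_at k (\<lambda>y. X y $ i)) x"
    by (rule pderiv_at_commute[OF open_U x X dX])
  then have comm: "D k l - D l k + C l k - C k l =
      (pderiv_at k (E l i) x + Q l k) - (pderiv_at l (E k i) x + Q k l)"
    unfolding second by simp
  have C: "C l k = (\<Sum>j\<in>UNIV. (\<Sum>m\<in>UNIV. ?\<Gamma> x i k m * ?\<Gamma> x m l j) * X x $ j)" for k l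
    unfolding C_def sum_distrib_left sum_distrib_right
    by (subst sum.swap) (simp add: mult.assoc)
  have "(\<Sum>j\<in>UNIV. riem_up G x i j k l * X x $ j) = D k l - D l k + C l k - C k l"
    unfolding riem_up_def C D_def
    by (simp add: sum.distrib sum_subtractf left_diff_distrib distrib_right)
  then show ?thesis unfolding comm Q_def .
qed

end

section \<open>Conformal change and parallel fields\<close>

lemma sum_mult_delta:
  fixes f :: "'n::finite \<Rightarrow> real"
  shows "(\<Sum>l\<in>UNIV. (if l = k then c else 0) * f l) = c * f k"
    "(\<Sum>l\<in>UNIV. (if k = l then c else 0) * f l) = c * f k"
    "(\<Sum>l\<in>UNIV. f l * (if l = k then c else 0)) = c * f k"
    "(\<Sum>l\<in>UNIV. f l * (if k = l then c else 0)) = c * f k"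
  by (simp_all add: if_distrib[of "\<lambda>a. a * _"] if_distrib[of "\<lambda>a. _ * a"] mult.commute cong: if_cong)

context coordinate_metric
begin

text \<open>By uniqueness of the Levi-Civita connection it suffices that the right side is symmetric
  and compatible with \<open>G'\<close>; the inverse of \<open>G'\<close> is never expanded.\<close>

lemma conformal_christoffel:
  assumes G': "coordinate_metric G' U" and conf: "\<And>y. y \<in> U \<Longrightarrow> G' y = exp (2 * \<phi> y) *\<^sub>R G y"
    and \<phi>: "\<And>y. y \<in> U \<Longrightarrow> \<phi> differentiable at y" and x: "x \<in> U"
  shows "christoffel G' x k i j = christoffel G x k i j
    + (if k = i then pderiv_at j \<phi> x else 0) + (if k = j then pderiv_at i \<phi> x else 0)
    - G x $ i $ j * (\<Sum>l\<in>UNIV. matrix_inv (G x) $ k $ l * pderiv_at l \<phi> x)"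
proof -
  interpret G': coordinate_metric G' U by fact
  define B where "B k = (\<Sum>l\<in>UNIV. matrix_inv (G x) $ k $ l * pderiv_at l \<phi> x)" for k
  define \<Gamma> where "\<Gamma> k i j = christoffel G x k i j + (if k = i then pderiv_at j \<phi> x else 0)
    + (if k = j then pderiv_at i \<phi> x else 0) - G x $ i $ j * B k" for k i j
  have GB: "(\<Sum>l\<in>UNIV. B l * G x $ l $ j) = pderiv_at j \<phi> x" for j
  proof -
    have "(\<Sum>l\<in>UNIV. B l * G x $ l $ j) =
        (\<Sum>l\<in>UNIV. \<Sum>m\<in>UNIV. matrix_inv (G x) $ m $ l * G x $ l $ j * pderiv_at m \<phi> x)"
      unfolding B_def sum_distrib_right
      by (intro sum.cong refl) (simp add: matrix_inv_symmetric[OF inv[OF x] sym[OF x], of _ _])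
    also have "\<dots> = (\<Sum>m\<in>UNIV. \<Sum>l\<in>UNIV. matrix_inv (G x) $ m $ l * G x $ l $ j * pderiv_at m \<phi> x)"
      by (rule sum.swap)
    also have "\<dots> = (\<Sum>m\<in>UNIV. (if m = j then 1 else 0) * pderiv_at m \<phi> x)"
      by (simp add: sum_distrib_right[symmetric] inv_left[OF x])
    also have "\<dots> = pderiv_at j \<phi> x" by (simp only: sum_mult_delta mult_1)
    finally show ?thesis .
  qed
  have "\<Gamma> k i j = \<Gamma> k j i" for k i j
    unfolding \<Gamma>_def using christoffel_sym[OF x, of k i j] sym[OF x, of i j] by simp
  moreover have "pderiv_at k (\<lambda>y. G' y $ i $ j) x =
      (\<Sum>l\<in>UNIV. \<Gamma> l k i * G' x $ l $ j) + (\<Sum>l\<in>UNIV. \<Gamma> l k j * G' x $ i $ l)" for k i j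
  proof -
    \<comment> \<open>Adding this to the same formula with \<open>i\<close> and \<open>j\<close>
      exchanged leaves the correction \<open>2 * pderiv_at k \<phi> x * G x $ i $ j\<close>, which
      accounts for differentiating the conformal factor.\<close>
    have s: "(\<Sum>l\<in>UNIV. \<Gamma> l k i * G x $ l $ j) = (\<Sum>l\<in>UNIV. christoffel G x l k i * G x $ l $ j)
        + pderiv_at i \<phi> x * G x $ k $ j + pderiv_at k \<phi> x * G x $ i $ j - G x $ k $ i * pderiv_at j \<phi> x" for i j
    proof -
      have "(\<Sum>l\<in>UNIV. \<Gamma> l k i * G x $ l $ j) = (\<Sum>l\<in>UNIV. christoffel G x l k i * G x $ l $ j)
        + (\<Sum>l\<in>UNIV. (if l = k then pderiv_at i \<phi> x else 0) * G x $ l $ j)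
        + (\<Sum>l\<in>UNIV. (if l = i then pderiv_at k \<phi> x else 0) * G x $ l $ j)
        - G x $ k $ i * (\<Sum>l\<in>UNIV. B l * G x $ l $ j)"
        unfolding \<Gamma>_def by (simp only: left_diff_distrib distrib_right sum.distrib sum_subtractf sum_distrib_left mult.assoc)
      then show ?thesis by (simp only: sum_mult_delta GB)
    qed
    have "pderiv_at k (\<lambda>y. G' y $ i $ j) x = pderiv_at k (\<lambda>y. exp (2 * \<phi> y) * G y $ i $ j) x"
      by (rule pderiv_at_cong[OF open_U x]) (simp add: conf)
    also have "\<dots> = exp (2 * \<phi> x) * (2 * pderiv_at k \<phi> x) * G x $ i $ j
        + exp (2 * \<phi> x) * pderiv_at k (\<lambda>y. G y $ i $ j) x"
    proof -
      have d: "(\<lambda>y. 2 * \<phi> y) differentiable at x" using \<phi>[OF x] by simp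
      have "(\<lambda>y. exp (2 * \<phi> y)) differentiable at x"
        using d differentiable_compose[of exp "\<lambda>y. 2 * \<phi> y" x UNIV]
        by (simp add: field_differentiable_imp_differentiable field_differentiable_within_exp)
      moreover have "pderiv_at k (\<lambda>y. 2 * \<phi> y) x = 2 * pderiv_at k \<phi> x"
        using pderiv_at_mult[OF differentiable_const[of 2] \<phi>[OF x], of k] by (simp add: pderiv_at_const)
      ultimately show ?thesis by (simp add: pderiv_at_mult pderiv_at_exp[OF d] diff[OF x])
    qed
    also have "\<dots> = exp (2 * \<phi> x) * ((\<Sum>l\<in>UNIV. \<Gamma> l k i * G x $ l $ j) + (\<Sum>l\<in>UNIV. \<Gamma> l k j * G x $ l $ i))"
      unfolding s metric_compat[OF x]
      using sym[OF x, of j i] sym[OF x, of k i] sym[OF x, of k j]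
      by (simp add: algebra_simps sym[OF x, of i])
    also have "\<dots> = (\<Sum>l\<in>UNIV. \<Gamma> l k i * G' x $ l $ j) + (\<Sum>l\<in>UNIV. \<Gamma> l k j * G' x $ i $ l)"
      by (simp add: conf[OF x] distrib_left sum_distrib_left mult.left_commute sym[OF x, of i])
    finally show ?thesis .
  qed
  ultimately have "\<Gamma> = christoffel G' x"
    using christoffel_unique[OF open_U x G'.sym G'.inv[OF x] G'.diff[OF x], THEN iffD1] by blast
  then have "christoffel G' x k i j = \<Gamma> k i j" by simp
  then show ?thesis unfolding \<Gamma>_def B_def .
qed

lemma conformal_coordinate_metric:
  assumes conf: "\<And>y. y \<in> U \<Longrightarrow> G' y = exp (2 * \<phi> y) *\<^sub>R G y"
    and \<phi>: "\<And>y. y \<in> U \<Longrightarrow> \<phi> differentiable at y"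
    and \<phi>2: "\<And>y k. y \<in> U \<Longrightarrow> pderiv_at k \<phi> differentiable at y"
  shows "coordinate_metric G' U"
proof
  have d: "(\<lambda>y. 2 * \<phi> y) differentiable at y" if "y \<in> U" for y using \<phi>[OF that] by simp
  have e: "(\<lambda>y. exp (2 * \<phi> y)) differentiable at y" if "y \<in> U" for y
    using d[OF that] differentiable_compose[of exp "\<lambda>y. 2 * \<phi> y" y UNIV]
    by (simp add: field_differentiable_imp_differentiable field_differentiable_within_exp)
  show "open U" by (rule open_U)
  fix y i j assume y: "y \<in> U"
  show "G' y $ i $ j = G' y $ j $ i" using conf[OF y] sym[OF y, of i j] by simp
  show "invertible (G' y)" unfolding conf[OF y] by (rule scalar_invertible) (auto simp: inv[OF y])
  show "(\<lambda>y. G' y $ i $ j) differentiable at y"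
    by (rule differentiable_cong_open[OF open_U y _ differentiable_mult[OF e[OF y] diff[OF y, of i j]]]) (simp add: conf)
  fix k
  have pd: "pderiv_at k (\<lambda>y. G' y $ i $ j) y = exp (2 * \<phi> y) * (2 * pderiv_at k \<phi> y) * G y $ i $ j
        + exp (2 * \<phi> y) * pderiv_at k (\<lambda>y. G y $ i $ j) y" if y: "y \<in> U" for y
  proof -
    have "pderiv_at k (\<lambda>y. G' y $ i $ j) y = pderiv_at k (\<lambda>y. exp (2 * \<phi> y) * G y $ i $ j) y"
      by (rule pderiv_at_cong[OF open_U y]) (simp add: conf)
    moreover have "pderiv_at k (\<lambda>y. 2 * \<phi> y) y = 2 * pderiv_at k \<phi> y"
      using pderiv_at_mult[OF differentiable_const[of 2] \<phi>[OF y], of k] by (simp add: pderiv_at_const)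
    ultimately show ?thesis by (simp add: pderiv_at_mult pderiv_at_exp[OF d[OF y]] diff[OF y] e[OF y])
  qed
  have "(\<lambda>y. exp (2 * \<phi> y) * (2 * pderiv_at k \<phi> y) * G y $ i $ j
        + exp (2 * \<phi> y) * pderiv_at k (\<lambda>y. G y $ i $ j) y) differentiable at y"
    by (intro differentiable_add differentiable_mult differentiable_const e y \<phi>2 diff diff2)
  then show "pderiv_at k (\<lambda>y. G' y $ i $ j) differentiable at y"
    by (rule differentiable_cong_open[OF open_U y, rotated]) (rule pd[symmetric])
qed

text \<open>For a parallel field the dual form satisfies \<open>\<partial>\<^sub>k \<xi>\<^sub>l =
  \<Gamma>\<^sup>m\<^sub>k\<^sub>l \<xi>\<^sub>m\<close>, which is symmetric because the connection
  has no torsion.\<close>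

lemma parallel_lowered_closed:
  assumes x: "x \<in> U" and X: "\<And>i. (\<lambda>y. X y $ i) differentiable at x"
    and par: "\<And>i k. cov_deriv G X x i k = 0"
  shows "pderiv_at k (\<lambda>y. \<Sum>j\<in>UNIV. G y $ l $ j * X y $ j) x = pderiv_at l (\<lambda>y. \<Sum>j\<in>UNIV. G y $ k $ j * X y $ j) x"
proof -
  let ?\<Gamma> = "christoffel G x"
  have "pderiv_at k (\<lambda>y. \<Sum>j\<in>UNIV. G y $ l $ j * X y $ j) x =
      (\<Sum>j\<in>UNIV. (\<Sum>m\<in>UNIV. ?\<Gamma> m k l * G x $ m $ j) * X x $ j)" for k l
  proof -
    have dX: "pderiv_at k (\<lambda>y. X y $ j) x = - (\<Sum>m\<in>UNIV. ?\<Gamma> j k m * X x $ m)" for j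
      using par[of k j] unfolding cov_deriv_def by simp
    have "pderiv_at k (\<lambda>y. \<Sum>j\<in>UNIV. G y $ l $ j * X y $ j) x =
        (\<Sum>j\<in>UNIV. pderiv_at k (\<lambda>y. G y $ l $ j * X y $ j) x)"
      by (intro pderiv_at_sum differentiable_mult diff X x)
    also have "\<dots> = (\<Sum>j\<in>UNIV. (\<Sum>m\<in>UNIV. ?\<Gamma> m k l * G x $ m $ j) * X x $ j)
        + ((\<Sum>j\<in>UNIV. \<Sum>m\<in>UNIV. ?\<Gamma> m k j * G x $ l $ m * X x $ j)
        - (\<Sum>j\<in>UNIV. \<Sum>m\<in>UNIV. G x $ l $ j * (?\<Gamma> j k m * X x $ m)))"
      by (simp add: pderiv_at_mult diff X x dX metric_compat[OF x] distrib_right sum.distrib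
          sum_subtractf sum_distrib_right sum_distrib_left)
    also have "(\<Sum>j\<in>UNIV. \<Sum>m\<in>UNIV. ?\<Gamma> m k j * G x $ l $ m * X x $ j) =
        (\<Sum>j\<in>UNIV. \<Sum>m\<in>UNIV. G x $ l $ j * (?\<Gamma> j k m * X x $ m))"
      by (subst sum.swap) (simp add: mult_ac)
    finally show ?thesis by simp
  qed
  then show ?thesis by (simp add: christoffel_sym[OF x, of _ k l])
qed

text \<open>With respect to the conformally changed metric, \<open>\<nabla>\<^sub>l X\<^sup>i = \<sigma> \<delta>\<^sup>i\<^sub>l + \<phi>\<^sub>l X\<^sup>i - \<xi>\<^sub>l B\<^sup>i\<close>, where
  \<open>\<sigma> = d\<phi>(X)\<close>, \<open>\<phi>\<^sub>l\<close> are the partial derivatives of \<open>\<phi>\<close>, \<open>\<xi>\<close> is the closed form dual to \<open>X\<close> and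
  \<open>B\<close> is the gradient of \<open>\<phi>\<close>. The Ricci identity turns this into the curvature formula.\<close>

lemma conformal_parallel_curvature:
  assumes G': "coordinate_metric G' U" and conf: "\<And>y. y \<in> U \<Longrightarrow> G' y = exp (2 * \<phi> y) *\<^sub>R G y"
    and \<phi>: "\<And>y. y \<in> U \<Longrightarrow> \<phi> differentiable at y"
    and \<phi>2: "\<And>y k. y \<in> U \<Longrightarrow> pderiv_at k \<phi> differentiable at y"
    and X: "\<And>y i. y \<in> U \<Longrightarrow> (\<lambda>y. X y $ i) differentiable at y"
    and par: "\<And>y i k. y \<in> U \<Longrightarrow> cov_deriv G X y i k = 0" and x: "x \<in> U"
  shows "\<exists>a m P. \<forall>i k l. (\<Sum>j\<in>UNIV. riem_up G' x i j k l * X x $ j) =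
    a k * (if i = l then 1 else 0) - a l * (if i = k then 1 else 0) + m k l * X x $ i
    + (\<Sum>j\<in>UNIV. G x $ k $ j * X x $ j) * P l i - (\<Sum>j\<in>UNIV. G x $ l $ j * X x $ j) * P k i"
proof -
  interpret G': coordinate_metric G' U by fact
  define f where "f l y = pderiv_at l \<phi> y" for l y
  define \<sigma> where "\<sigma> y = (\<Sum>j\<in>UNIV. f j y * X y $ j)" for y
  define \<xi> where "\<xi> l y = (\<Sum>j\<in>UNIV. G y $ l $ j * X y $ j)" for l y
  define B where "B i y = (\<Sum>l\<in>UNIV. matrix_inv (G y) $ i $ l * f l y)" for i y
  define dl where "dl i l = (if i = l then 1 else (0::real))" for i l :: 'n
  define E where "E l i y = \<sigma> y * dl i l + f l y * X y $ i - \<xi> l y * B i y" for l i y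
  let ?\<Gamma> = "christoffel G'"
  have df: "f l differentiable at x" for l unfolding f_def[abs_def] using \<phi>2[OF x] .
  have d\<sigma>: "\<sigma> differentiable at x" unfolding \<sigma>_def[abs_def]
    by (intro differentiable_sum differentiable_mult ballI df X x) auto
  have d\<xi>: "\<xi> l differentiable at x" for l unfolding \<xi>_def[abs_def]
    by (intro differentiable_sum differentiable_mult ballI diff X x) auto
  have dB: "B i differentiable at x" for i unfolding B_def[abs_def]
    by (intro differentiable_sum differentiable_mult ballI df differentiable_inv x) auto
  have d1: "(\<lambda>y. \<sigma> y * dl i l) differentiable at x" "(\<lambda>y. f l y * X y $ i) differentiable at x"
    "(\<lambda>y. \<xi> l y * B i y) differentiable at x" for i l
    by (intro differentiable_mult d\<sigma> df d\<xi> dB X x differentiable_const)+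
  have dE: "E l i differentiable at x" for l i
    unfolding E_def[abs_def] by (intro differentiable_add differentiable_diff d1)
  have eq: "pderiv_at l (\<lambda>y. X y $ i) y = E l i y - (\<Sum>j\<in>UNIV. ?\<Gamma> y i l j * X y $ j)" if y: "y \<in> U" for y l i
  proof -
    have "(\<Sum>j\<in>UNIV. ?\<Gamma> y i l j * X y $ j) = (\<Sum>j\<in>UNIV. christoffel G y i l j * X y $ j)
        + dl i l * \<sigma> y + (\<Sum>j\<in>UNIV. (if i = j then f l y else 0) * X y $ j) - \<xi> l y * B i y"
    proof -
      have 1: "?\<Gamma> y i l j * X y $ j = christoffel G y i l j * X y $ j + dl i l * (f j y * X y $ j)
          + (if i = j then f l y else 0) * X y $ j - G y $ l $ j * X y $ j * B i y" for j
        using arg_cong[OF conformal_christoffel[OF G' conf \<phi> y, of i l j], of "\<lambda>c. c * X y $ j"]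
        unfolding B_def f_def dl_def by (simp add: algebra_simps)
      show ?thesis unfolding 1 \<sigma>_def \<xi>_def
        by (simp only: sum.distrib sum_subtractf sum_distrib_left sum_distrib_right)
    qed
    then show ?thesis using par[OF y, of l i] unfolding cov_deriv_def E_def
      by (simp add: sum_mult_delta mult.commute)
  qed
  \<comment> \<open>The covariant derivative of the gradient enters only with a factor \<xi>, so it
    can stay inside the unspecified tensor \<open>P\<close>.\<close>
  define C where "C k i = pderiv_at k (B i) x + (\<Sum>j\<in>UNIV. ?\<Gamma> x i k j * B j x)" for k i
  have D: "pderiv_at k (E l i) x + (\<Sum>j\<in>UNIV. ?\<Gamma> x i k j * E l j x) =
      pderiv_at k \<sigma> x * dl i l + pderiv_at k (f l) x * X x $ i + f l x * E k i x
      - pderiv_at k (\<xi> l) x * B i x + \<sigma> x * ?\<Gamma> x i k l - \<xi> l x * C k i" for k l i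
  proof -
    have "pderiv_at k (E l i) x = pderiv_at k (\<lambda>y. \<sigma> y * dl i l + f l y * X y $ i) x - pderiv_at k (\<lambda>y. \<xi> l y * B i y) x"
      unfolding E_def[abs_def] by (intro pderiv_at_diff differentiable_add d1)
    also have "\<dots> = pderiv_at k (\<lambda>y. \<sigma> y * dl i l) x + pderiv_at k (\<lambda>y. f l y * X y $ i) x - pderiv_at k (\<lambda>y. \<xi> l y * B i y) x"
      by (simp only: pderiv_at_add[OF d1(1) d1(2)])
    also have "\<dots> = pderiv_at k \<sigma> x * dl i l + (pderiv_at k (f l) x * X x $ i + f l x * pderiv_at k (\<lambda>y. X y $ i) x)
        - (pderiv_at k (\<xi> l) x * B i x + \<xi> l x * pderiv_at k (B i) x)"
      by (simp only: pderiv_at_mult[OF d\<sigma> differentiable_const] pderiv_at_mult[OF df X[OF x]]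
          pderiv_at_mult[OF d\<xi> dB] pderiv_at_const mult_zero_right add_0_right)
    finally have 1: "pderiv_at k (E l i) x = \<dots>" .
    have "(\<Sum>j\<in>UNIV. ?\<Gamma> x i k j * E l j x) = (\<Sum>j\<in>UNIV. ?\<Gamma> x i k j * (\<sigma> x * dl j l))
        + f l x * (\<Sum>j\<in>UNIV. ?\<Gamma> x i k j * X x $ j) - \<xi> l x * (\<Sum>j\<in>UNIV. ?\<Gamma> x i k j * B j x)"
      unfolding E_def by (simp add: distrib_left right_diff_distrib sum.distrib sum_subtractf sum_distrib_left mult_ac)
    also have "(\<Sum>j\<in>UNIV. ?\<Gamma> x i k j * (\<sigma> x * dl j l)) = \<sigma> x * ?\<Gamma> x i k l"
      unfolding dl_def by (simp add: sum_distrib_left[symmetric] if_distrib[of "\<lambda>a. _ * a"] cong: if_cong)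
    finally show ?thesis unfolding 1 eq[OF x] C_def by (simp add: algebra_simps)
  qed
  \<comment> \<open>Closedness removes the term with the antisymmetrized derivative of \<xi> times
    \<open>B i\<close>, which has none of the admissible shapes.\<close>
  have closed: "pderiv_at k (\<xi> l) x = pderiv_at l (\<xi> k) x" for k l
    unfolding \<xi>_def[abs_def] by (rule parallel_lowered_closed[OF x X[OF x] par[OF x]])
  \<comment> \<open>In f_l E_k - f_k E_l the terms with f_k f_l cancel, those with \<sigma> go into
    \<open>a\<close> and those with \<open>B\<close> into \<open>P\<close>.\<close>
  have "(\<Sum>j\<in>UNIV. riem_up G' x i j k l * X x $ j) =
      (pderiv_at k \<sigma> x - f k x * \<sigma> x) * dl i l - (pderiv_at l \<sigma> x - f l x * \<sigma> x) * dl i k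
      + (pderiv_at k (f l) x - pderiv_at l (f k) x) * X x $ i
      + \<xi> k x * (C l i - f l x * B i x) - \<xi> l x * (C k i - f k x * B i x)" for i k l
    using G'.ricci_identity[OF x X dE eq, of i k l] closed[of k l] G'.christoffel_sym[OF x, of i k l]
    unfolding D unfolding E_def by (simp add: algebra_simps)
  then show ?thesis unfolding dl_def \<xi>_def
    by (intro exI[of _ "\<lambda>k. pderiv_at k \<sigma> x - f k x * \<sigma> x"] exI[of _ "\<lambda>k l. pderiv_at k (f l) x - pderiv_at l (f k) x"]
        exI[of _ "\<lambda>l i. C l i - f l x * B i x"]) blast
qed

lemma conformal_parallel_weyl:
  assumes G': "coordinate_metric G' U" and conf: "\<And>y. y \<in> U \<Longrightarrow> G' y = exp (2 * \<phi> y) *\<^sub>R G y"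
    and \<phi>: "\<And>y. y \<in> U \<Longrightarrow> \<phi> differentiable at y"
    and \<phi>2: "\<And>y k. y \<in> U \<Longrightarrow> pderiv_at k \<phi> differentiable at y"
    and X: "\<And>y i. y \<in> U \<Longrightarrow> (\<lambda>y. X y $ i) differentiable at y"
    and par: "\<And>y i k. y \<in> U \<Longrightarrow> cov_deriv G X y i k = 0" and x: "x \<in> U"
    and n: "CARD('n) \<noteq> 2" and b: "b = contract2 (\<lambda>i j. G' x $ i $ j)" and N: "b (X x) (X x) \<noteq> 0"
    and w: "b (X x) w = 0" and z: "b (X x) z = 0" and t: "b (X x) t = 0"
  shows "contract4 (weyl G' x) (X x) w z t = 0"
proof -
  interpret G': coordinate_metric G' U by fact
  define \<xi> where "\<xi> i = (\<Sum>j\<in>UNIV. G' x $ i $ j * X x $ j)" for i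
  have b\<xi>: "b (X x) u = contract1 \<xi> u" for u
    unfolding b contract2_swap[of "\<lambda>i j. G' x $ i $ j", symmetric] unfolding contract2_def contract1_def \<xi>_def
    by (simp add: G'.sym[OF x, of _ i for i] sum_distrib_right sum_distrib_left mult_ac)
  obtain a m P where R: "\<And>i k l. (\<Sum>j\<in>UNIV. riem_up G' x i j k l * X x $ j) =
    a k * (if i = l then 1 else 0) - a l * (if i = k then 1 else 0) + m k l * X x $ i
    + (\<Sum>j\<in>UNIV. G x $ k $ j * X x $ j) * P l i - (\<Sum>j\<in>UNIV. G x $ l $ j * X x $ j) * P k i"
    using conformal_parallel_curvature[OF G' conf \<phi> \<phi>2 X par x] by blast
  have \<xi>0: "(\<Sum>j\<in>UNIV. G x $ k $ j * X x $ j) = exp (- 2 * \<phi> x) * \<xi> k" for k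
    unfolding \<xi>_def conf[OF x] by (simp add: sum_distrib_left mult.assoc[symmetric] exp_minus)
  \<comment> \<open>The form \<xi> lowered with \<open>G\<close> differs from the one lowered with
    \<open>G'\<close> by the factor \<open>exp (- 2 * \<phi> x)\<close>; together with the lowering
    of \<open>i\<close> it is absorbed into \<open>P\<close>.\<close>
  define P' where "P' l i = (\<Sum>r\<in>UNIV. G' x $ i $ r * (exp (- 2 * \<phi> x) * P l r))" for l i
  have main: "(\<Sum>j\<in>UNIV. riem G' x i j k l * X x $ j) =
      a k * G' x $ i $ l - a l * G' x $ i $ k + m k l * \<xi> i + \<xi> k * P' l i - \<xi> l * P' k i" for i k l
  proof -
    have "(\<Sum>j\<in>UNIV. riem G' x i j k l * X x $ j) =
        (\<Sum>r\<in>UNIV. G' x $ i $ r * (\<Sum>j\<in>UNIV. riem_up G' x r j k l * X x $ j))"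
      unfolding riem_def sum_distrib_right sum_distrib_left by (subst sum.swap) (simp add: mult.assoc)
    also have "\<dots> = a k * (\<Sum>r\<in>UNIV. G' x $ i $ r * (if r = l then 1 else 0))
        - a l * (\<Sum>r\<in>UNIV. G' x $ i $ r * (if r = k then 1 else 0))
        + m k l * \<xi> i + \<xi> k * P' l i - \<xi> l * P' k i"
      unfolding R \<xi>0 P'_def \<xi>_def[of i]
      by (simp only: distrib_left right_diff_distrib sum.distrib sum_subtractf sum_distrib_left mult_ac)
    finally show ?thesis by (simp add: sum_mult_delta)
  qed
  have "contract4 (\<lambda>i j k l. riem G' x i j k l - kulkarni_nomizu (schouten G' x) (\<lambda>a b. G' x $ a $ b) i j k l) w (X x) z t = 0"
    using N w z t unfolding b\<xi>
    by (rule weyl_contraction_eq_zero[OF G'.sym[OF x] matrix_inv_inverse[OF G'.inv[OF x]]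
        G'.riem_antisym_first[OF x] \<xi>_def _ main ricci_def schouten_def n])
  then have "contract4 (weyl G' x) w (X x) z t = 0" unfolding weyl_def[abs_def] .
  \<comment> \<open>The Ricci identity contracts \<open>X\<close> into the second slot, while the
    Weyl operator on wedges with \<open>X\<close> has it in the first.\<close>
  moreover have "weyl G' x = (\<lambda>i j k l. - weyl G' x j i k l)"
    by (intro ext) (rule G'.weyl_antisym_first[OF x])
  then have "contract4 (weyl G' x) (X x) w z t = - contract4 (\<lambda>i j k l. weyl G' x j i k l) (X x) w z t"
    using contract4_neg[of "\<lambda>i j k l. weyl G' x j i k l" "X x" w z t] by simp
  ultimately show ?thesis by (simp add: contract4_swap12[of "weyl G' x"])
qed

end

section \<open>Passage to the manifold\<close>

text \<open>The map \<open>L\<close> lets one statement serve matrix entries, vector components and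
  scalar functions.\<close>

lemma smooth_on_imp_C2:
  fixes F :: "real ^ 'n::finite \<Rightarrow> 'b::real_normed_vector" and L :: "'b \<Rightarrow> real"
  assumes F: "smooth_on F S" and S: "open S" "y \<in> S" and L: "bounded_linear L"
  shows "(\<lambda>y. L (F y)) differentiable at y" "pderiv_at k (\<lambda>y. L (F y)) differentiable at y"
proof -
  have "Ck_on (Suc (Suc 0)) F S" using F unfolding smooth_on_def by blast
  then have F1: "F differentiable_on S" and F2: "(\<lambda>x. frechet_derivative F (at x) (axis k 1)) differentiable_on S"
    by auto
  have dF: "F differentiable at y" if "y \<in> S" for y
    using F1 S(1) that differentiable_on_eq_differentiable_at by blast
  have hd: "((\<lambda>y. L (F y)) has_derivative (\<lambda>h. L (frechet_derivative F (at y) h))) (at y)" if "y \<in> S" for y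
    using bounded_linear.has_derivative[OF L dF[OF that, unfolded frechet_derivative_works]] .
  show "(\<lambda>y. L (F y)) differentiable at y" using hd[OF S(2)] unfolding differentiable_def by blast
  have pd: "pderiv_at k (\<lambda>y. L (F y)) y = L (frechet_derivative F (at y) (axis k 1))" if "y \<in> S" for y
    using pderiv_at_eq[OF hd[OF that]] .
  have "(\<lambda>x. frechet_derivative F (at x) (axis k 1)) differentiable at y"
    using F2 S differentiable_on_eq_differentiable_at by blast
  then have "(\<lambda>x. L (frechet_derivative F (at x) (axis k 1))) differentiable at y"
    unfolding differentiable_def using bounded_linear.has_derivative[OF L] by blast
  then show "pderiv_at k (\<lambda>y. L (F y)) differentiable at y"
    by (rule differentiable_cong_open[OF S, rotated]) (rule pd[symmetric])
qed

lemma bounded_linear_vec_nth_nth: "bounded_linear (\<lambda>M :: real ^ 'n::finite ^ 'm::finite. M $ i $ j)"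
  by (rule bounded_linear_compose[OF bounded_linear_vec_nth bounded_linear_vec_nth])

lemma chart_open:
  assumes "smooth_manifold M A" "c \<in> A"
  shows "open (cimg c)" "cdom c \<subseteq> topspace M" "inj_on (cmap c) (cdom c)"
proof -
  have c: "openin M (cdom c)" "open (cimg c)"
      "homeomorphic_map (subtopology M (cdom c)) (top_of_set (cimg c)) (cmap c)"
    using assms unfolding smooth_manifold_def by blast+
  show "open (cimg c)" using c by blast
  show sub: "cdom c \<subseteq> topspace M" using c(1) by (rule openin_subset)
  show "inj_on (cmap c) (cdom c)"
    using c(3) sub unfolding homeomorphic_eq_everything_map by (simp add: Int_absorb1)
qed

lemma to_chart_chart_at:
  assumes "smooth_manifold M A" "p \<in> topspace M"
  shows "to_chart A (chart_at A p) p v = v"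
proof -
  let ?c = "chart_at A p"
  note c = chart_at[OF assms]
  have "((\<lambda>x. x) has_derivative (\<lambda>x. x)) (at (cmap ?c p))" by (rule has_derivative_ident)
  then have "(cmap ?c \<circ> cinv ?c has_derivative (\<lambda>x. x)) (at (cmap ?c p))"
    by (rule has_derivative_transform_within_open[OF _ chart_open(1)[OF assms(1) c(1)]])
      (use c in \<open>auto simp: f_inv_into_f\<close>)
  then show ?thesis
    unfolding to_chart_def by (rule fun_cong[OF frechet_derivative_at, symmetric])
qed

theorem theorem1p3:
  fixes M :: "'a topology" and A :: "('a, 'n::finite) chart set" and g :: "('a, 'n) metric_field"
  assumes "smooth_manifold M A"
    and "riemannian_metric M A g"
    and "CARD('n) \<ge> 4"
    and "\<exists>h\<in>conformal_class A g. \<exists>X. parallel_field A h X \<and> (\<forall>p\<in>topspace M. X p \<noteq> 0)"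
  shows "(\<forall>p\<in>topspace M. \<exists>v. v \<noteq> 0 \<and>
            (\<forall>h\<in>conformal_class A g.
               weyl_operator A h p ` wedge_perp (h p) v \<subseteq> wedge_perp (h p) v))
       \<and> (\<forall>p\<in>topspace M. \<forall>h\<in>conformal_class A g. \<exists>E :: (real ^ 'n ^ 'n) set.
            card E = CARD('n) - 1 \<and> independent E \<and>
            (\<forall>\<omega>\<in>E. simple_bivector \<omega> \<and> \<omega> \<noteq> 0 \<and> (\<exists>\<mu>. weyl_operator A h p \<omega> = \<mu> *\<^sub>R \<omega>)))"
proof -
  obtain h0 X where h0: "h0 \<in> conformal_class A g" and par: "parallel_field A h0 X"
    and X0: "\<And>p. p \<in> topspace M \<Longrightarrow> X p \<noteq> 0"
    using assms(4) by blast
  obtain f0 where f0: "smooth_fun A f0" "h0 = (\<lambda>p v w. exp (2 * f0 p) * g p v w)"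
    using h0 unfolding conformal_class_def by blast
  have main: "weyl_operator A h p ` wedge_perp (h p) (X p) \<subseteq> wedge_perp (h p) (X p)
      \<and> (\<exists>E. card E = CARD('n) - 1 \<and> independent E \<and>
        (\<forall>\<omega>\<in>E. simple_bivector \<omega> \<and> \<omega> \<noteq> 0 \<and> (\<exists>\<mu>. weyl_operator A h p \<omega> = \<mu> *\<^sub>R \<omega>)))"
    if p: "p \<in> topspace M" and h: "h \<in> conformal_class A g" for p h
  proof -
    define c where "c = chart_at A p"
    have cA: "c \<in> A" and pc: "p \<in> cdom c" unfolding c_def using chart_at[OF assms(1) p] by auto
    note co = chart_open[OF assms(1) cA]
    define x where "x = cmap c p"
    have xV: "x \<in> cimg c" unfolding x_def using pc by blast
    have cx: "cinv c x = p" unfolding x_def using co(3) pc by simp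
    have top: "cinv c y \<in> topspace M" if "y \<in> cimg c" for y
      using inv_into_into[OF that] co(2) by blast
    obtain f where f: "smooth_fun A f" "h = (\<lambda>p v w. exp (2 * f p) * g p v w)"
      using h unfolding conformal_class_def by blast
    have bg: "bilinear (g q)" "\<And>v w. g q v w = g q w v" "\<And>v. v \<noteq> 0 \<Longrightarrow> 0 < g q v v"
      if "q \<in> topspace M" for q
      using assms(2) that unfolding riemannian_metric_def by blast+
    have bh: "bilinear (h p)" unfolding f(2) using bg(1)[OF p]
      by (simp add: bilinear_def linear_iff algebra_simps)
    have sh: "h p v w = h p w v" for v w unfolding f(2) using bg(2)[OF p, of v w] by simp
    have ph: "v \<noteq> 0 \<Longrightarrow> 0 < h p v v" for v unfolding f(2) using bg(3)[OF p, of v] by simp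
    \<comment> \<open>At \<open>x\<close> the coordinate vectors are the standard basis, since
      \<open>c\<close> is the chart that represents the tangent space at \<open>p\<close>.\<close>
    have at_x: "metric_coord A k c x = gram (k p)" for k :: "('a, 'n) metric_field"
      unfolding metric_coord_def gram_def cx by (simp add: c_def coord_vec_chart_at[OF assms(1) p])
    have sg: "smooth_on (metric_coord A g c) (cimg c)" using assms(2) cA unfolding riemannian_metric_def by blast
    have dg: "(\<lambda>y. metric_coord A g c y $ i $ j) differentiable at y"
      "pderiv_at k (\<lambda>y. metric_coord A g c y $ i $ j) differentiable at y" if "y \<in> cimg c" for y i j k
      using smooth_on_imp_C2[OF sg co(1) that bounded_linear_vec_nth_nth] by blast+
    have ig: "invertible (metric_coord A g c x)"
      unfolding at_x by (rule invertible_gram) (use bg[OF p] in auto)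
    obtain U where U: "open U" "x \<in> U" "U \<subseteq> cimg c" "\<And>y. y \<in> U \<Longrightarrow> invertible (metric_coord A g c y)"
      using open_invertible[OF co(1) xV dg(1) ig] by blast
    interpret Gg: coordinate_metric "metric_coord A g c" U
    proof
      fix y i j k assume y: "y \<in> U"
      then have yV: "y \<in> cimg c" using U(3) by blast
      show "metric_coord A g c y $ i $ j = metric_coord A g c y $ j $ i"
        unfolding metric_coord_def by (simp add: bg(2)[OF top[OF yV], of "coord_vec A c (cinv c y) i"])
      show "invertible (metric_coord A g c y)" using U(4) y .
      show "(\<lambda>y. metric_coord A g c y $ i $ j) differentiable at y" using dg(1)[OF yV] .
      show "pderiv_at k (\<lambda>y. metric_coord A g c y $ i $ j) differentiable at y" using dg(2)[OF yV] .
    qed (rule U(1))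
    have df: "(\<lambda>y. e (cinv c y)) differentiable at y" "pderiv_at k (\<lambda>y. e (cinv c y)) differentiable at y"
      if "smooth_fun A e" "y \<in> U" for e y k
    proof -
      have "smooth_on (e \<circ> cinv c) (cimg c)" using that(1) cA unfolding smooth_fun_def by blast
      from smooth_on_imp_C2[OF this co(1) _ bounded_linear_ident] that(2) U(3)
      show "(\<lambda>y. e (cinv c y)) differentiable at y" "pderiv_at k (\<lambda>y. e (cinv c y)) differentiable at y"
        by (auto simp: comp_def)
    qed
    have conf: "metric_coord A (\<lambda>p v w. exp (2 * e p) * g p v w) c y = exp (2 * e (cinv c y)) *\<^sub>R metric_coord A g c y"
      for e y unfolding metric_coord_def by (simp add: vec_eq_iff)
    interpret G0: coordinate_metric "metric_coord A h0 c" U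
      unfolding f0(2) by (rule Gg.conformal_coordinate_metric[where \<phi> = "\<lambda>y. f0 (cinv c y)", OF conf[of f0] df[OF f0(1)]])
    have Gh: "coordinate_metric (metric_coord A h c) U"
      unfolding f(2) by (rule Gg.conformal_coordinate_metric[where \<phi> = "\<lambda>y. f (cinv c y)", OF conf[of f] df[OF f(1)]])
    \<comment> \<open>Both \<open>h\<close> and \<open>h0\<close> are given relative to
      \<open>g\<close>; the parallel field lives with \<open>h0\<close>, so \<open>h\<close> is
      rewritten relative to \<open>h0\<close>.\<close>
    define \<phi> where "\<phi> y = f (cinv c y) - f0 (cinv c y)" for y
    have confh: "metric_coord A h c y = exp (2 * \<phi> y) *\<^sub>R metric_coord A h0 c y" for y
      unfolding f(2) f0(2) conf \<phi>_def by (simp add: right_diff_distrib exp_diff)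
    have d\<phi>: "\<phi> differentiable at y" if "y \<in> U" for y
      unfolding \<phi>_def[abs_def] by (intro differentiable_diff df f(1) f0(1) that)
    have d\<phi>2: "pderiv_at k \<phi> differentiable at y" if y: "y \<in> U" for y k
    proof (rule differentiable_cong_open[OF U(1) y])
      show "(\<lambda>y. pderiv_at k (\<lambda>y. f (cinv c y)) y - pderiv_at k (\<lambda>y. f0 (cinv c y)) y) differentiable at y"
        by (intro differentiable_diff df f(1) f0(1) y)
      show "pderiv_at k (\<lambda>y. f (cinv c y)) y - pderiv_at k (\<lambda>y. f0 (cinv c y)) y = pderiv_at k \<phi> y"
        if "y \<in> U" for y
        unfolding \<phi>_def[abs_def] by (intro pderiv_at_diff[symmetric] df f(1) f0(1) that)
    qed
    define Y where "Y = field_coord A X c"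
    have sY: "smooth_on Y (cimg c)" and parY: "\<And>y i k. y \<in> cimg c \<Longrightarrow> cov_deriv (metric_coord A h0 c) Y y i k = 0"
      using par cA unfolding Y_def parallel_field_def smooth_vector_field_def by blast+
    have dY: "(\<lambda>y. Y y $ i) differentiable at y" if "y \<in> U" for y i
      by (rule smooth_on_imp_C2(1)[OF sY co(1) _ bounded_linear_vec_nth]) (use that U(3) in blast)
    have Yx: "Y x = X p" unfolding Y_def field_coord_def cx unfolding c_def by (rule to_chart_chart_at[OF assms(1) p])
    have hp: "h p = contract2 (\<lambda>i j. metric_coord A h c x $ i $ j)"
      unfolding at_x by (intro ext) (rule contract2_gram[OF bh, symmetric])
    interpret Gh: coordinate_metric "metric_coord A h c" U by (rule Gh)
    define W where "W = weyl (metric_coord A h c) x"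
    have W0: "contract4 W (X p) w z t = 0" if "h p (X p) w = 0" "h p (X p) z = 0" "h p (X p) t = 0" for w z t
      unfolding W_def Yx[symmetric]
    proof (rule G0.conformal_parallel_weyl[OF Gh confh d\<phi> d\<phi>2 dY _ U(2) _ hp])
      show "cov_deriv (metric_coord A h0 c) Y y i k = 0" if "y \<in> U" for y i k using parY that U(3) by blast
      show "CARD('n) \<noteq> 2" using assms(3) by simp
      show "h p (Y x) (Y x) \<noteq> 0" unfolding Yx using ph[OF X0[OF p]] by simp
    qed (simp_all add: Yx that)
    have Wfold: "weyl (metric_coord A h (chart_at A p)) (cmap (chart_at A p) p) = W"
      unfolding W_def x_def c_def ..
    have W1: "W i j k l = - W j i k l" and W2: "W i j k l = - W i j l k" and W3: "W i j k l = W k l i j" for i j k l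
      unfolding W_def by (rule Gh.weyl_antisym_first[OF U(2)], rule Gh.weyl_antisym_last, rule Gh.weyl_pair_symmetry[OF U(2)])
    note T = weyl_operator_spec[where A = A and g = h and p = p, unfolded Wfold, OF bh sh ph W1 W2]
    show ?thesis
      by (intro conjI weyl_operator_preserves_wedge_perp[OF bh sh ph X0[OF p] T W3 W0])
  qed
  \<comment> \<open>The vector \<open>X p\<close> is fixed before \<open>h\<close>, which gives one
    \<open>v\<close> for the whole conformal class.\<close>
  then show ?thesis using X0 by blast
qed

end
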